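(* Any overring of an ISP-domain is also an ISP-domain.
   Context: All rings are commutative and unitary; "ideal" of a domain means integral ideal. A domain $A$ is an ISP-domain (invertible semiprime domain) if every proper nonzero ideal $I$ of $A$ can be written as $I=JQ_1\cdots Q_n$ where $n\geq 1$, $J$ is an invertible ideal of $A$ and each $Q_i$ is a proper radical ideal of $A$. An overring of a domain $A$ is a ring $B$ with $A\subseteq B\subseteq K$, where $K$ is the quotient field of $A$. *)

theory Defs
  imports "HOL-Algebra.Algebra"
begin

text \<open>
  A domain \<open>A\<close> is a subring of its quotient field \<open>K\<close>; as a ring it is
  \<open>K\<lparr>carrier := A\<rparr>\<close>.  A subring of a field is automatically a domain, and every domain
  arises in this way up to isomorphism.
\<close>

definition is_quotient_field :: "('a, 'm) ring_scheme \<Rightarrow> 'a set \<Rightarrow> bool" where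
  "is_quotient_field K A \<longleftrightarrow>
     field K \<and> subring A K \<and>
     carrier K = {a \<otimes>\<^bsub>K\<^esub> inv\<^bsub>K\<^esub> b | a b. a \<in> A \<and> b \<in> A - {\<zero>\<^bsub>K\<^esub>}}"

definition overring :: "('a, 'm) ring_scheme \<Rightarrow> 'a set \<Rightarrow> 'a set \<Rightarrow> bool" where
  "overring K A B \<longleftrightarrow> subring B K \<and> A \<subseteq> B"

text \<open>The zero module is allowed here as a fractional ideal.\<close>

definition fractional_ideal :: "('a, 'm) ring_scheme \<Rightarrow> 'a set \<Rightarrow> 'a set \<Rightarrow> bool" where
  "fractional_ideal K A L \<longleftrightarrow>
     additive_subgroup L K \<and>
     (\<forall>a\<in>A. \<forall>x\<in>L. a \<otimes>\<^bsub>K\<^esub> x \<in> L) \<and>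
     (\<exists>d\<in>A - {\<zero>\<^bsub>K\<^esub>}. \<forall>x\<in>L. d \<otimes>\<^bsub>K\<^esub> x \<in> A)"

text \<open>
  \<^const>\<open>ideal_prod\<close> uses only the addition and multiplication of its ring argument, so over
  \<open>K\<close> it is the usual product of \<open>A\<close>-submodules of \<open>K\<close>.
\<close>

definition invertible_ideal :: "('a, 'm) ring_scheme \<Rightarrow> 'a set \<Rightarrow> 'a set \<Rightarrow> bool" where
  "invertible_ideal K A J \<longleftrightarrow>
     ideal J (K\<lparr>carrier := A\<rparr>) \<and> (\<exists>L. fractional_ideal K A L \<and> J \<cdot>\<^bsub>K\<^esub> L = A)"

definition radical :: "('a, 'm) ring_scheme \<Rightarrow> 'a set \<Rightarrow> 'a set" where
  "radical R I = {x \<in> carrier R. \<exists>n::nat. n > 0 \<and> x [^]\<^bsub>R\<^esub> n \<in> I}"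

definition radical_ideal :: "('a, 'm) ring_scheme \<Rightarrow> 'a set \<Rightarrow> bool" where
  "radical_ideal R Q \<longleftrightarrow> ideal Q R \<and> radical R Q = Q"

text \<open>
  The list \<open>Qs\<close> holds the factors \<open>Q\<^sub>1, \<dots>, Q\<^sub>n\<close>, and the \<^const>\<open>foldl\<close> term is
  \<open>((J \<cdot> Q\<^sub>1) \<cdot> Q\<^sub>2) \<dots> \<cdot> Q\<^sub>n\<close>.
\<close>

definition ISP_domain :: "('a, 'm) ring_scheme \<Rightarrow> 'a set \<Rightarrow> bool" where
  "ISP_domain K A \<longleftrightarrow>
     is_quotient_field K A \<and>
     (\<forall>I. ideal I (K\<lparr>carrier := A\<rparr>) \<and> I \<noteq> A \<and> I \<noteq> {\<zero>\<^bsub>K\<^esub>} \<longrightarrow>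
        (\<exists>J Qs. invertible_ideal K A J \<and> length Qs \<ge> 1 \<and>
           (\<forall>Q \<in> set Qs. radical_ideal (K\<lparr>carrier := A\<rparr>) Q \<and> Q \<noteq> A) \<and>
           I = foldl (ideal_prod (K\<lparr>carrier := A\<rparr>)) J Qs))"

end

theory Submission
  imports Defs
begin

text \<open>
  Over a flat overring \<open>B\<close> of \<open>A\<close> every ideal \<open>I\<close> equals \<open>(I \<inter> A) B\<close>, and extension to \<open>B\<close>
  preserves products, invertibility and radicality, so a factorization of \<open>I \<inter> A\<close> extends to one
  of \<open>I\<close>; the factors \<open>Q B = B\<close> are dropped.  If all were dropped, \<open>I \<inter> A = J Q\<^sub>1 \<dots> Q\<^sub>n\<close> would
  contain \<open>J\<close>, and cancelling \<open>J\<close> would give \<open>Q\<^sub>1 = A\<close>.  Hence it suffices that an ISP-domain is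
  a Pruefer domain, all of whose overrings are flat.

  Localizations are flat, hence again ISP.  In a local ISP-domain that is not a field the maximal
  ideal is principal.  For \<open>t\<close> in the quotient field put \<open>D = A : t\<close>, and suppose that \<open>D + D t\<close> is
  proper.  Localize at a minimal prime over it: all radical factors become the maximal ideal, so
  \<open>D + D t = (y)\<close> is principal.  Then \<open>D / y\<close> is contained in \<open>D\<close>, and \<open>1 \<in> D + D t\<close> after all.
\<close>

context field
begin

text \<open>One transfer argument serves twice: for localizations, whose flatness is elementary,
  and, once these have yielded the Pruefer property, for arbitrary overrings. This order keeps the
  argument from being circular. Localizing at a maximal ideal would not do, since the radical
  factors of an ideal could still be many different ideals. Over a prime minimal above the ideal,
  every prime containing a proper radical ideal above it is the maximal ideal, and so is the radical
  ideal itself. A generator of a maximal ideal \<open>M\<close> is sought outside the square of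
  \<open>M\<close>, so the obstacle is an idempotent \<open>M\<close>. It is excluded in
  localizations where \<open>M\<close> is the only proper radical ideal above some prime
  \<open>P\<close> and an element \<open>d\<close> outside \<open>P\<close>. The general local case
  is then reduced to such a localization. No finiteness is known for \<open>D\<close>, so
  invertibility of \<open>D + D t\<close> is not reached through generators; division by a generator
  \<open>y\<close> replaces that.\<close>

definition submodule_of :: "'a set \<Rightarrow> 'a set \<Rightarrow> bool" where
  "submodule_of A I \<longleftrightarrow> I \<subseteq> carrier R \<and> \<zero> \<in> I \<and> (\<forall>x\<in>I. \<forall>y\<in>I. x \<oplus> y \<in> I) \<and>
     (\<forall>a\<in>A. \<forall>x\<in>I. a \<otimes> x \<in> I)"

definition ideal_of :: "'a set \<Rightarrow> 'a set \<Rightarrow> bool" where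
  "ideal_of A I \<longleftrightarrow> submodule_of A I \<and> I \<subseteq> A"

text \<open>Closure under square roots suffices for an ideal to be radical, and avoids powers.\<close>

definition semiprime_of :: "'a set \<Rightarrow> 'a set \<Rightarrow> bool" where
  "semiprime_of A Q \<longleftrightarrow> ideal_of A Q \<and> (\<forall>x\<in>A. x \<otimes> x \<in> Q \<longrightarrow> x \<in> Q)"

definition prime_of :: "'a set \<Rightarrow> 'a set \<Rightarrow> bool" where
  "prime_of A P \<longleftrightarrow> ideal_of A P \<and> \<one> \<notin> P \<and> (\<forall>x\<in>A. \<forall>y\<in>A. x \<otimes> y \<in> P \<longrightarrow> x \<in> P \<or> y \<in> P)"

definition invertible_of :: "'a set \<Rightarrow> 'a set \<Rightarrow> bool" where
  "invertible_of A J \<longleftrightarrow> ideal_of A J \<and> (\<exists>L. submodule_of A L \<and> J \<cdot> L = A)"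

definition principal :: "'a set \<Rightarrow> 'a \<Rightarrow> 'a set" where
  "principal A c = (\<lambda>r. c \<otimes> r) ` A"

text \<open>Nesting to the right and ending with the unit \<open>A\<close> lets inductions peel off
  the first factor without an accumulator; \<open>foldl_ideal_prod\<close> links it to the
  left-nested product in \<open>ISP_domain\<close>.\<close>

definition ideal_prods :: "'a set \<Rightarrow> 'a set list \<Rightarrow> 'a set" where
  "ideal_prods A Qs = foldr (\<cdot>) Qs A"

text \<open>\<open>ISP_domain\<close> restated inside the field; \<open>ISP_domain_iff_isp\<close>
  proves the two equivalent.\<close>

definition isp :: "'a set \<Rightarrow> bool" where
  "isp A \<longleftrightarrow> subring A R \<and> (\<forall>x\<in>carrier R. \<exists>b\<in>A. b \<noteq> \<zero> \<and> b \<otimes> x \<in> A) \<and>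
     (\<forall>I. ideal_of A I \<and> \<one> \<notin> I \<and> I \<noteq> {\<zero>} \<longrightarrow>
        (\<exists>J Qs. invertible_of A J \<and> Qs \<noteq> [] \<and> (\<forall>Q\<in>set Qs. semiprime_of A Q \<and> \<one> \<notin> Q) \<and>
           I = J \<cdot> ideal_prods A Qs))"

text \<open>\<open>inv\<close> is taken in the field, so for a subring \<open>A\<close> the second
  condition makes every element outside \<open>M\<close> a unit of \<open>A\<close>:
  \<open>M\<close> is the unique maximal ideal.\<close>

definition local_of :: "'a set \<Rightarrow> 'a set \<Rightarrow> bool" where
  "local_of A M \<longleftrightarrow> prime_of A M \<and> (\<forall>x\<in>A - M. inv x \<in> A)"

definition colon :: "'a set \<Rightarrow> 'a set \<Rightarrow> 'a \<Rightarrow> 'a set" where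
  "colon A I x = {a \<in> A. a \<otimes> x \<in> I}"

text \<open>The module of fractions of \<open>I\<close> at \<open>N\<close>, realized in the field.
  The first argument only supplies denominators, so \<open>localize A N A\<close> is the local ring
  and \<open>localize A N N\<close> its maximal ideal.\<close>

definition localize :: "'a set \<Rightarrow> 'a set \<Rightarrow> 'a set \<Rightarrow> 'a set" where
  "localize A N I = {x \<in> carrier R. \<exists>s\<in>A - N. s \<otimes> x \<in> I}"

text \<open>\<open>(A : x) B = B\<close> for all \<open>x \<in> B\<close> is an elementwise characterization of flat overrings.\<close>

definition flat_overring :: "'a set \<Rightarrow> 'a set \<Rightarrow> bool" where
  "flat_overring A B \<longleftrightarrow> subring B R \<and> A \<subseteq> B \<and> (\<forall>x\<in>B. \<one> \<in> colon A A x \<cdot> B)"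

lemmas ring_ac = l_distr r_distr m_assoc m_comm m_lcomm a_ac

section \<open>Submodules of the field and their products\<close>

lemma one_in_ideal_iff:
  assumes "subring A R" "ideal_of A I"
  shows "\<one> \<in> I \<longleftrightarrow> I = A"
proof
  assume "\<one> \<in> I"
  moreover have "a \<otimes> \<one> = a" if "a \<in> A" for a
    using that subringE(1)[OF assms(1)] by auto
  ultimately show "I = A"
    using assms(2) unfolding ideal_of_def submodule_of_def by (metis subsetI subset_antisym)
qed (use subringE(3)[OF assms(1)] in auto)

lemma subring_submodule: "subring A R \<Longrightarrow> submodule_of A A"
  unfolding submodule_of_def by (auto dest: subringE)

lemma subring_ideal: "subring A R \<Longrightarrow> ideal_of A A"
  by (simp add: ideal_of_def subring_submodule)

lemma submodule_minus:
  assumes "subring A R" "submodule_of A I" "x \<in> I"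
  shows "\<ominus> x \<in> I"
proof -
  have "x \<in> carrier R" using assms unfolding submodule_of_def by auto
  hence "\<ominus> x = (\<ominus> \<one>) \<otimes> x" by (simp add: l_minus)
  thus ?thesis
    using assms subringE(3,5)[OF assms(1)] unfolding submodule_of_def by metis
qed

lemma submodule_diff:
  assumes "subring A R" "submodule_of A I" "x \<in> I" "y \<in> I"
  shows "x \<ominus> y \<in> I"
  unfolding minus_eq using assms submodule_minus[OF assms(1,2,4)] unfolding submodule_of_def by auto

lemma submodule_lmult: "submodule_of A I \<Longrightarrow> a \<in> A \<Longrightarrow> x \<in> I \<Longrightarrow> a \<otimes> x \<in> I"
  unfolding submodule_of_def by auto

lemma submodule_rmult:
  "submodule_of A I \<Longrightarrow> A \<subseteq> carrier R \<Longrightarrow> a \<in> A \<Longrightarrow> x \<in> I \<Longrightarrow> x \<otimes> a \<in> I"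
  unfolding submodule_of_def by (metis m_comm subsetD)

lemma submodule_add: "submodule_of A I \<Longrightarrow> x \<in> I \<Longrightarrow> y \<in> I \<Longrightarrow> x \<oplus> y \<in> I"
  unfolding submodule_of_def by auto

lemma submodule_zero: "submodule_of A I \<Longrightarrow> \<zero> \<in> I"
  unfolding submodule_of_def by auto

lemma submodule_carrier: "submodule_of A I \<Longrightarrow> I \<subseteq> carrier R"
  unfolding submodule_of_def by auto

lemma ideal_submodule: "ideal_of A I \<Longrightarrow> submodule_of A I"
  unfolding ideal_of_def by auto

lemma ideal_subset: "ideal_of A I \<Longrightarrow> I \<subseteq> A"
  unfolding ideal_of_def by auto

lemma ideal_prod_le:
  assumes "\<And>i j. i \<in> I \<Longrightarrow> j \<in> J \<Longrightarrow> i \<otimes> j \<in> L" "\<And>x y. x \<in> L \<Longrightarrow> y \<in> L \<Longrightarrow> x \<oplus> y \<in> L"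
  shows "I \<cdot> J \<subseteq> L"
proof
  fix x assume "x \<in> I \<cdot> J"
  thus "x \<in> L" by induct (auto intro: assms)
qed

lemma ideal_prod_mono: "I \<subseteq> I' \<Longrightarrow> J \<subseteq> J' \<Longrightarrow> I \<cdot> J \<subseteq> I' \<cdot> J'"
  by (rule ideal_prod_le) (auto intro: ideal_prod.intros)

lemma ideal_prod_closed: "I \<subseteq> carrier R \<Longrightarrow> J \<subseteq> carrier R \<Longrightarrow> I \<cdot> J \<subseteq> carrier R"
  by (rule ideal_prod_le) auto

lemma ideal_prod_comm:
  assumes "I \<subseteq> carrier R" "J \<subseteq> carrier R"
  shows "I \<cdot> J = J \<cdot> I"
proof -
  have "I \<cdot> J \<subseteq> J \<cdot> I" if "I \<subseteq> carrier R" "J \<subseteq> carrier R" for I J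
    by (rule ideal_prod_le) (metis that m_comm subsetD ideal_prod.prod, rule ideal_prod.sum)
  thus ?thesis using assms by blast
qed

lemma ideal_prod_assoc:
  assumes "I \<subseteq> carrier R" "J \<subseteq> carrier R" "L \<subseteq> carrier R"
  shows "I \<cdot> J \<cdot> L = I \<cdot> (J \<cdot> L)"
proof -
  have le: "I \<cdot> J \<cdot> L \<subseteq> I \<cdot> (J \<cdot> L)"
    if c: "I \<subseteq> carrier R" "J \<subseteq> carrier R" "L \<subseteq> carrier R" for I J L
  proof (rule ideal_prod_le)
    fix x l assume "x \<in> I \<cdot> J" and l: "l \<in> L"
    thus "x \<otimes> l \<in> I \<cdot> (J \<cdot> L)"
    proof induct
      case (prod i j)
      hence "i \<otimes> j \<otimes> l = i \<otimes> (j \<otimes> l)" using c by (meson m_assoc subsetD)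
      thus ?case using prod by (auto intro: ideal_prod.intros)
    next
      case (sum x y)
      hence "(x \<oplus> y) \<otimes> l = x \<otimes> l \<oplus> y \<otimes> l"
        using c ideal_prod_closed[OF c(1,2)] by (meson l_distr subsetD)
      thus ?case using sum by (auto intro: ideal_prod.intros)
    qed
  qed (rule ideal_prod.sum)
  \<comment> \<open>The reverse inclusion is the first one applied to the factors in reverse
    order.\<close>
  have "I \<cdot> (J \<cdot> L) = L \<cdot> J \<cdot> I"
    using assms by (metis ideal_prod_comm ideal_prod_closed)
  also have "\<dots> \<subseteq> L \<cdot> (J \<cdot> I)" using le assms by blast
  also have "\<dots> = I \<cdot> J \<cdot> L"
    using assms by (metis ideal_prod_comm ideal_prod_closed)
  finally show ?thesis using le[OF assms] by blast
qed

lemma submodule_ideal_prod: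
  assumes "A \<subseteq> carrier R" "submodule_of A I" "submodule_of A J"
  shows "submodule_of A (I \<cdot> J)"
proof -
  note c = submodule_carrier[OF assms(2)] submodule_carrier[OF assms(3)]
  have "a \<otimes> x \<in> I \<cdot> J" if a: "a \<in> A" and "x \<in> I \<cdot> J" for a x
    using that(2)
  proof induct
    case (prod i j)
    hence "a \<otimes> (i \<otimes> j) = (a \<otimes> i) \<otimes> j" using c a assms(1) by (metis m_assoc subsetD)
    thus ?case using prod a assms by (auto intro: ideal_prod.intros submodule_lmult)
  next
    case (sum x y)
    hence "a \<otimes> (x \<oplus> y) = a \<otimes> x \<oplus> a \<otimes> y"
      using a assms(1) ideal_prod_closed[OF c] by (meson r_distr subsetD)
    thus ?case using sum by (auto intro: ideal_prod.intros)
  qed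
  moreover have "\<zero> \<in> I \<cdot> J"
    using ideal_prod.prod[of \<zero> I \<zero> J R] assms submodule_zero by auto
  ultimately show ?thesis
    unfolding submodule_of_def using ideal_prod_closed[OF c] by (auto intro: ideal_prod.sum)
qed

lemma ideal_prod_unit:
  assumes "subring A R" "submodule_of A I"
  shows "I \<cdot> A = I"
proof
  show "I \<cdot> A \<subseteq> I"
    by (rule ideal_prod_le)
      (use assms subringE(1)[OF assms(1)] in \<open>auto intro: submodule_rmult submodule_add\<close>)
  show "I \<subseteq> I \<cdot> A"
  proof
    fix x assume x: "x \<in> I"
    hence "x \<otimes> \<one> = x" using submodule_carrier[OF assms(2)] by auto
    thus "x \<in> I \<cdot> A" using ideal_prod.prod[of x I \<one> A R] x subringE(3)[OF assms(1)] by auto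
  qed
qed

lemma ideal_prod_unit_left:
  assumes "subring A R" "submodule_of A I"
  shows "A \<cdot> I = I"
  using ideal_prod_unit[OF assms] ideal_prod_comm subringE(1)[OF assms(1)]
    submodule_carrier[OF assms(2)] by metis

lemma ideal_prod_subset_left:
  assumes "subring A R" "submodule_of A I" "J \<subseteq> A"
  shows "I \<cdot> J \<subseteq> I"
  using ideal_prod_mono[OF subset_refl assms(3)] ideal_prod_unit[OF assms(1,2)] by blast

lemma ideal_prod_subset_right:
  assumes "subring A R" "submodule_of A I" "J \<subseteq> A"
  shows "J \<cdot> I \<subseteq> I"
  using ideal_prod_mono[OF assms(3) subset_refl] ideal_prod_unit_left[OF assms(1,2)] by blast

lemma ideal_of_ideal_prod:
  assumes "subring A R" "ideal_of A I" "ideal_of A J"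
  shows "ideal_of A (I \<cdot> J)"
  using submodule_ideal_prod[OF subringE(1)[OF assms(1)]] ideal_prod_subset_left[OF assms(1), of I J] assms
  unfolding ideal_of_def by blast

lemma ideal_prods_Nil [simp]: "ideal_prods A [] = A"
  by (simp add: ideal_prods_def)

lemma ideal_prods_Cons [simp]: "ideal_prods A (Q # Qs) = Q \<cdot> ideal_prods A Qs"
  by (simp add: ideal_prods_def)

lemma ideal_of_ideal_prods:
  assumes "subring A R" "\<forall>Q\<in>set Qs. ideal_of A Q"
  shows "ideal_of A (ideal_prods A Qs)"
  using assms(2) by (induct Qs) (auto simp: subring_ideal assms(1) ideal_of_ideal_prod)

lemma foldl_ideal_prod:
  assumes "subring A R" "submodule_of A J" "\<forall>Q\<in>set Qs. ideal_of A Q"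
  shows "foldl (\<cdot>) J Qs = J \<cdot> ideal_prods A Qs"
  using assms(2,3)
proof (induct Qs arbitrary: J)
  case Nil
  thus ?case by (simp add: ideal_prod_unit assms(1))
next
  case (Cons Q Qs)
  have "foldl (\<cdot>) (J \<cdot> Q) Qs = (J \<cdot> Q) \<cdot> ideal_prods A Qs"
    using Cons submodule_ideal_prod[OF subringE(1)[OF assms(1)]] by (simp add: ideal_submodule)
  also have "\<dots> = J \<cdot> (Q \<cdot> ideal_prods A Qs)"
    by (rule ideal_prod_assoc)
      (use Cons ideal_of_ideal_prods[OF assms(1), of Qs] in
        \<open>auto simp: ideal_of_def submodule_of_def\<close>)
  finally show ?case by simp
qed

section \<open>Sums and principal submodules\<close>

lemma submodule_set_add:
  assumes "A \<subseteq> carrier R" "submodule_of A I" "submodule_of A J"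
  shows "submodule_of A (I <+>\<^bsub>R\<^esub> J)"
  unfolding submodule_of_def
proof (intro conjI ballI)
  note c = submodule_carrier[OF assms(2)] submodule_carrier[OF assms(3)]
  show "I <+>\<^bsub>R\<^esub> J \<subseteq> carrier R" using c by (auto simp: set_add_def')
  show "\<zero> \<in> I <+>\<^bsub>R\<^esub> J"
    using submodule_zero[OF assms(2)] submodule_zero[OF assms(3)]
    by (auto simp: set_add_def' intro!: bexI[of _ \<zero>])
  fix x assume "x \<in> I <+>\<^bsub>R\<^esub> J"
  then obtain i j where x: "i \<in> I" "j \<in> J" "x = i \<oplus> j" by (auto simp: set_add_def')
  hence xc: "i \<in> carrier R" "j \<in> carrier R" using c by auto
  { fix y assume "y \<in> I <+>\<^bsub>R\<^esub> J"
    then obtain k l where y: "k \<in> I" "l \<in> J" "y = k \<oplus> l" by (auto simp: set_add_def')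
    hence yc: "k \<in> carrier R" "l \<in> carrier R" using c by auto
    have "x \<oplus> y = (i \<oplus> k) \<oplus> (j \<oplus> l)" using xc yc x y by (simp add: a_ac)
    moreover have "i \<oplus> k \<in> I" "j \<oplus> l \<in> J" using x y assms submodule_add by auto
    ultimately show "x \<oplus> y \<in> I <+>\<^bsub>R\<^esub> J" by (auto simp: set_add_def') }
  fix a assume a: "a \<in> A"
  hence "a \<otimes> x = a \<otimes> i \<oplus> a \<otimes> j" using x xc assms(1) by (auto simp: r_distr)
  moreover have "a \<otimes> i \<in> I" "a \<otimes> j \<in> J" using a x assms submodule_lmult by auto
  ultimately show "a \<otimes> x \<in> I <+>\<^bsub>R\<^esub> J" by (auto simp: set_add_def')
qed

lemma set_addI: "x \<in> I \<Longrightarrow> y \<in> J \<Longrightarrow> x \<oplus> y \<in> I <+>\<^bsub>R\<^esub> J"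
  by (auto simp: set_add_def')

lemma set_add_supersets:
  assumes "submodule_of A I" "submodule_of A J"
  shows "I \<subseteq> I <+>\<^bsub>R\<^esub> J" "J \<subseteq> I <+>\<^bsub>R\<^esub> J"
proof -
  note c = submodule_carrier[OF assms(1)] submodule_carrier[OF assms(2)]
  show "I \<subseteq> I <+>\<^bsub>R\<^esub> J"
    using set_addI[of _ I \<zero> J] submodule_zero[OF assms(2)] c by (metis r_zero subset_iff)
  show "J \<subseteq> I <+>\<^bsub>R\<^esub> J"
    using set_addI[of \<zero> I _ J] submodule_zero[OF assms(1)] c by (metis l_zero subset_iff)
qed

lemma set_add_least:
  assumes "submodule_of A L" "I \<subseteq> L" "J \<subseteq> L"
  shows "I <+>\<^bsub>R\<^esub> J \<subseteq> L"
  using assms by (auto simp: set_add_def' submodule_add subset_iff)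

lemma ideal_set_add:
  assumes "subring A R" "ideal_of A I" "ideal_of A J"
  shows "ideal_of A (I <+>\<^bsub>R\<^esub> J)"
  using submodule_set_add[OF subringE(1)[OF assms(1)]] set_add_least[OF subring_submodule[OF assms(1)]] assms
  unfolding ideal_of_def by blast

lemma submodule_principal:
  assumes "subring A R" "c \<in> carrier R"
  shows "submodule_of A (principal A c)"
  unfolding submodule_of_def
proof (intro conjI ballI)
  note A = subringE[OF assms(1)]
  show "principal A c \<subseteq> carrier R" using A assms by (auto simp: principal_def)
  show "\<zero> \<in> principal A c" unfolding principal_def using A assms by (intro image_eqI[of _ _ \<zero>]) auto
  fix x assume "x \<in> principal A c"
  then obtain r where r: "r \<in> A" "x = c \<otimes> r" by (auto simp: principal_def)
  { fix y assume "y \<in> principal A c"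
    then obtain s where "s \<in> A" "y = c \<otimes> s" by (auto simp: principal_def)
    thus "x \<oplus> y \<in> principal A c"
      unfolding principal_def using A r assms
      by (intro image_eqI[of _ _ "r \<oplus> s"]) (auto simp: r_distr subset_iff) }
  fix a assume "a \<in> A"
  thus "a \<otimes> x \<in> principal A c"
    unfolding principal_def using A r assms
    by (intro image_eqI[of _ _ "a \<otimes> r"]) (auto simp: m_lcomm subset_iff)
qed

lemma principal_self:
  assumes "subring A R" "c \<in> carrier R"
  shows "c \<in> principal A c"
  unfolding principal_def using assms subringE(3)[OF assms(1)] by (intro image_eqI[of _ _ \<one>]) auto

lemma principal_subset:
  assumes "submodule_of A I" "A \<subseteq> carrier R" "c \<in> I"
  shows "principal A c \<subseteq> I"
  using assms submodule_rmult by (auto simp: principal_def)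

lemma ideal_principal:
  assumes "subring A R" "c \<in> A"
  shows "ideal_of A (principal A c)"
  unfolding ideal_of_def
  using submodule_principal[OF assms(1)] principal_subset[OF subring_submodule[OF assms(1)]]
    subringE(1)[OF assms(1)] assms by auto

lemma principal_prod:
  assumes "subring A R" "c \<in> carrier R" "d \<in> carrier R"
  shows "principal A c \<cdot> principal A d = principal A (c \<otimes> d)"
proof
  note A = subringE[OF assms(1)]
  have cd: "c \<otimes> d \<in> carrier R" using assms by auto
  have "c \<otimes> r \<otimes> (d \<otimes> s) = c \<otimes> d \<otimes> (r \<otimes> s)" if "r \<in> A" "s \<in> A" for r s
    using that A(1) assms by (auto simp: ring_ac subset_iff)
  hence 1: "i \<otimes> j \<in> principal A (c \<otimes> d)" if "i \<in> principal A c" "j \<in> principal A d" for i j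
    using that A(6) by (auto simp: principal_def)
  show "principal A c \<cdot> principal A d \<subseteq> principal A (c \<otimes> d)"
    by (rule ideal_prod_le) (use 1 submodule_add[OF submodule_principal[OF assms(1) cd]] in auto)
  show "principal A (c \<otimes> d) \<subseteq> principal A c \<cdot> principal A d"
    using principal_subset[OF submodule_ideal_prod[OF A(1) submodule_principal submodule_principal]]
      assms A(1) principal_self[OF assms(1)] by (meson ideal_prod.prod)
qed

lemma principal_one:
  assumes "subring A R"
  shows "principal A \<one> = A"
  unfolding principal_def using subringE(1)[OF assms] by (force simp: image_iff)


text \<open>Having a product with a principal module as an image lets the generator be cancelled
  element by element.\<close>

lemma principal_prod_submodule:
  assumes "subring A R" "c \<in> carrier R" "submodule_of A N"
  shows "principal A c \<cdot> N = (\<lambda>n. c \<otimes> n) ` N"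
proof
  note N = submodule_carrier[OF assms(3)] and A = subringE[OF assms(1)]
  show "principal A c \<cdot> N \<subseteq> (\<lambda>n. c \<otimes> n) ` N"
  proof (rule ideal_prod_le)
    fix i j assume "i \<in> principal A c" and j: "j \<in> N"
    then obtain r where r: "r \<in> A" "i = c \<otimes> r" by (auto simp: principal_def)
    have "r \<in> carrier R" "j \<in> carrier R" using r j A N by auto
    hence "i \<otimes> j = c \<otimes> (r \<otimes> j)" using assms r by (simp add: m_assoc)
    thus "i \<otimes> j \<in> (\<lambda>n. c \<otimes> n) ` N" using submodule_lmult[OF assms(3) r(1) j] by auto
  next
    fix x y assume "x \<in> (\<lambda>n. c \<otimes> n) ` N" "y \<in> (\<lambda>n. c \<otimes> n) ` N"
    then obtain n m where nm: "n \<in> N" "m \<in> N" "x = c \<otimes> n" "y = c \<otimes> m" by auto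
    hence "n \<in> carrier R" "m \<in> carrier R" using N by auto
    hence "x \<oplus> y = c \<otimes> (n \<oplus> m)" using assms nm by (simp add: r_distr)
    thus "x \<oplus> y \<in> (\<lambda>n. c \<otimes> n) ` N" using submodule_add[OF assms(3) nm(1,2)] by auto
  qed
  show "(\<lambda>n. c \<otimes> n) ` N \<subseteq> principal A c \<cdot> N"
    using principal_self[OF assms(1,2)] by (auto intro: ideal_prod.prod)
qed

section \<open>Prime ideals and localization\<close>

lemma ideal_colon:
  assumes "subring A R" "submodule_of A I" "x \<in> carrier R"
  shows "ideal_of A (colon A I x)"
  unfolding ideal_of_def submodule_of_def
proof (intro conjI ballI)
  note A = subringE[OF assms(1)]
  show "colon A I x \<subseteq> carrier R" "colon A I x \<subseteq> A" using A by (auto simp: colon_def)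
  show "\<zero> \<in> colon A I x" using A assms submodule_zero by (auto simp: colon_def)
  fix a assume a: "a \<in> colon A I x"
  { fix b assume "b \<in> colon A I x"
    thus "a \<oplus> b \<in> colon A I x"
      using a A assms by (auto simp: colon_def l_distr subset_iff submodule_add) }
  fix b assume "b \<in> A"
  thus "b \<otimes> a \<in> colon A I x"
    using a A assms by (auto simp: colon_def m_assoc subset_iff submodule_lmult)
qed

text \<open>If \<open>x \<otimes> x \<otimes> a \<in> P\<close>, then the square of
  \<open>x \<otimes> a\<close> is a multiple of that element, so
  \<open>x \<otimes> a \<in> P\<close>.\<close>

lemma semiprime_colon:
  assumes "subring A R" "semiprime_of A P" "a \<in> A"
  shows "semiprime_of A (colon A P a)" "P \<subseteq> colon A P a"
proof -
  note A = subringE[OF assms(1)]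
  have P: "ideal_of A P" "submodule_of A P" using assms by (auto simp: semiprime_of_def ideal_of_def)
  have "x \<in> colon A P a" if x: "x \<in> A" "x \<otimes> x \<in> colon A P a" for x
  proof -
    have c: "x \<in> carrier R" "a \<in> carrier R" using x assms(3) A(1) by auto
    hence "(x \<otimes> a) \<otimes> (x \<otimes> a) = a \<otimes> (x \<otimes> x \<otimes> a)"
      by (simp add: m_assoc m_comm m_lcomm)
    also have "\<dots> \<in> P" using x submodule_lmult[OF P(2) assms(3)] by (auto simp: colon_def)
    finally have "x \<otimes> a \<in> P" using assms(2,3) x(1) A(6) unfolding semiprime_of_def by blast
    thus ?thesis using x(1) by (simp add: colon_def)
  qed
  thus "semiprime_of A (colon A P a)"
    using ideal_colon[OF assms(1) P(2)] assms A(1) by (auto simp: semiprime_of_def)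
  show "P \<subseteq> colon A P a"
    using P submodule_rmult[OF P(2) A(1) assms(3)] by (auto simp: colon_def ideal_of_def)
qed

text \<open>
  A semiprime ideal that is maximal among those avoiding \<open>d\<close> is prime: if \<open>a \<otimes> b \<in> P\<close> with
  \<open>a, b \<notin> P\<close>, then \<open>P : a\<close> is a strictly larger semiprime ideal, so it contains \<open>d\<close>; then
  \<open>P : d\<close> contains \<open>a\<close>, is strictly larger too, and \<open>d \<otimes> d \<in> P\<close>.
\<close>

lemma prime_avoiding:
  assumes "subring A R" "semiprime_of A Q" "d \<in> A" "d \<notin> Q"
  obtains P where "prime_of A P" "Q \<subseteq> P" "d \<notin> P"
proof -
  note A = subringE[OF assms(1)]
  let ?S = "{I. semiprime_of A I \<and> Q \<subseteq> I \<and> d \<notin> I}"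
  have "\<exists>P\<in>?S. \<forall>H\<in>?S. P \<subseteq> H \<longrightarrow> H = P"
  proof (rule subset_Zorn_nonempty)
    show "?S \<noteq> {}" using assms by auto
    fix C assume ne: "C \<noteq> {}" and ch: "subset.chain ?S C"
    have mem: "semiprime_of A I" "submodule_of A I" "I \<subseteq> A" "I \<subseteq> carrier R" "Q \<subseteq> I" "d \<notin> I"
      if "I \<in> C" for I
      using that ch by (auto simp: subset_chain_def semiprime_of_def ideal_of_def submodule_of_def)
    have "submodule_of A (\<Union>C)"
      unfolding submodule_of_def
    proof (intro conjI ballI)
      show "\<Union>C \<subseteq> carrier R" using mem(4) by blast
      show "\<zero> \<in> \<Union>C" using mem(2) submodule_zero ne by blast
      fix x assume "x \<in> \<Union>C"
      then obtain I where I: "I \<in> C" "x \<in> I" by auto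
      show "a \<otimes> x \<in> \<Union>C" if "a \<in> A" for a
        using submodule_lmult[OF mem(2)[OF I(1)] that I(2)] I(1) by blast
      fix y assume "y \<in> \<Union>C"
      then obtain J where J: "J \<in> C" "y \<in> J" by auto
      have "I \<subseteq> J \<or> J \<subseteq> I" using ch I J by (auto simp: subset_chain_def)
      thus "x \<oplus> y \<in> \<Union>C" using I J submodule_add[OF mem(2)] by blast
    qed
    moreover have "\<Union>C \<subseteq> A" using mem(3) by blast
    \<comment> \<open>The condition on squares concerns a single element, so one member of the chain
      already settles it.\<close>
    moreover have "x \<in> \<Union>C" if "x \<in> A" "x \<otimes> x \<in> \<Union>C" for x
      using that mem(1) unfolding semiprime_of_def by blast
    ultimately have "semiprime_of A (\<Union>C)" by (auto simp: semiprime_of_def ideal_of_def)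
    moreover have "Q \<subseteq> \<Union>C" using mem(5) ne by blast
    moreover have "d \<notin> \<Union>C" using mem(6) by blast
    ultimately show "\<Union>C \<in> ?S" by blast
  qed
  then obtain P where P: "semiprime_of A P" "Q \<subseteq> P" "d \<notin> P"
    and max: "\<And>H. semiprime_of A H \<Longrightarrow> Q \<subseteq> H \<Longrightarrow> d \<notin> H \<Longrightarrow> P \<subseteq> H \<Longrightarrow> H = P"
    by auto
  have PA: "P \<subseteq> A" "ideal_of A P" using P by (auto simp: semiprime_of_def ideal_of_def)
  have "\<one> \<notin> P" using P(3) one_in_ideal_iff[OF assms(1) PA(2)] assms(3) by auto
  moreover have "x \<in> P \<or> y \<in> P" if x: "x \<in> A" and y: "y \<in> A" and xy: "x \<otimes> y \<in> P" for x y
  proof (rule ccontr)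
    assume n: "\<not> (x \<in> P \<or> y \<in> P)"
    have "y \<otimes> x \<in> P" using xy x y A(1) by (metis m_comm subsetD)
    hence "y \<in> colon A P x" using y by (auto simp: colon_def)
    hence "d \<in> colon A P x"
      using max[of "colon A P x"] semiprime_colon[OF assms(1) P(1) x] n P by blast
    hence "x \<in> colon A P d"
      using x assms(3) A(1) by (auto simp: colon_def m_comm subsetD)
    hence "d \<in> colon A P d"
      using max[of "colon A P d"] semiprime_colon[OF assms(1) P(1) assms(3)] n P by blast
    thus False using P assms(3) by (auto simp: colon_def semiprime_of_def)
  qed
  ultimately have "prime_of A P" using PA by (auto simp: prime_of_def)
  thus ?thesis using that P by auto
qed

lemma primeD:
  assumes "prime_of A P"
  shows "ideal_of A P" "P \<subseteq> A" "P \<subseteq> carrier R" "\<zero> \<in> P" "\<one> \<notin> P"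
    "\<And>x y. x \<in> P \<Longrightarrow> y \<in> P \<Longrightarrow> x \<oplus> y \<in> P"
    "\<And>x y. x \<in> A \<Longrightarrow> y \<in> P \<Longrightarrow> x \<otimes> y \<in> P"
    "\<And>x y. x \<in> A \<Longrightarrow> y \<in> A \<Longrightarrow> x \<otimes> y \<in> P \<Longrightarrow> x \<in> P \<or> y \<in> P"
  using assms by (simp_all add: prime_of_def ideal_of_def submodule_of_def)

lemma prime_contract:
  assumes "subring A R" "A \<subseteq> B" "prime_of B P"
  shows "prime_of A (P \<inter> A)"
  unfolding prime_of_def ideal_of_def submodule_of_def
  using primeD(3-8)[OF assms(3)] assms(2) subringE[OF assms(1)] by (simp add: subset_iff)

text \<open>Zorn's lemma is applied to the complements \<open>A - P\<close>, whose maximal elements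
  belong to minimal primes; a union of complements is the complement of the intersection of the
  primes.\<close>

lemma minimal_prime:
  assumes "prime_of A P0" "I \<subseteq> P0"
  obtains N where "prime_of A N" "I \<subseteq> N" "\<And>P. prime_of A P \<Longrightarrow> I \<subseteq> P \<Longrightarrow> P \<subseteq> N \<Longrightarrow> P = N"
proof -
  let ?S = "(\<lambda>P. A - P) ` {P. prime_of A P \<and> I \<subseteq> P}"
  have sub: "P \<subseteq> A" if "prime_of A P" for P using that by (auto simp: prime_of_def ideal_of_def)
  have "\<exists>M\<in>?S. \<forall>H\<in>?S. M \<subseteq> H \<longrightarrow> H = M"
  proof (rule subset_Zorn_nonempty)
    show "?S \<noteq> {}" using assms by auto
    fix C assume ne: "C \<noteq> {}" and ch: "subset.chain ?S C"
    have mem: "prime_of A (A - H)" "I \<subseteq> A - H" "H \<subseteq> A" if H: "H \<in> C" for H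
    proof -
      obtain P where P: "prime_of A P" "I \<subseteq> P" "H = A - P" using H ch by (auto simp: subset_chain_def)
      hence "A - H = P" using sub by blast
      thus "prime_of A (A - H)" "I \<subseteq> A - H" "H \<subseteq> A" using P by auto
    qed
    note m2 = primeD(3-8)[OF mem(1)]
    let ?P = "A - \<Union>C"
    have "prime_of A ?P"
      unfolding prime_of_def ideal_of_def submodule_of_def
    proof (intro conjI ballI impI)
      show "?P \<subseteq> carrier R" using m2(1) ne by blast
      show "\<zero> \<in> ?P" using m2(2) ne by blast
      show "?P \<subseteq> A" by auto
      show "\<one> \<notin> ?P" using m2(3) ne by blast
      show "x \<oplus> y \<in> ?P" if xy: "x \<in> ?P" "y \<in> ?P" for x y
        using m2(4)[of _ x y] xy ne by blast
      show "x \<otimes> y \<in> ?P" if xy: "x \<in> A" "y \<in> ?P" for x y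
        using m2(5)[of _ x y] xy ne by blast
      show "x \<in> ?P \<or> y \<in> ?P" if xy: "x \<in> A" "y \<in> A" "x \<otimes> y \<in> ?P" for x y
      proof (rule ccontr)
        assume "\<not> ?thesis"
        \<comment> \<open>Two elements outside the intersection are each missed by some prime of the
          chain; the smaller of the two primes misses both.\<close>
        then obtain H Y where XY: "H \<in> C" "Y \<in> C" "x \<in> H" "y \<in> Y" using xy by auto
        have "H \<subseteq> Y \<or> Y \<subseteq> H" using ch XY by (auto simp: subset_chain_def)
        then obtain Z where "Z \<in> C" "x \<in> Z" "y \<in> Z" using XY by auto
        thus False using m2(6)[of Z x y] xy by blast
      qed
    qed
    moreover have "I \<subseteq> ?P" using mem(2) ne by blast
    moreover have "\<Union>C = A - ?P" using mem(3) by blast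
    ultimately show "\<Union>C \<in> ?S" by blast
  qed
  then obtain N where N: "prime_of A N" "I \<subseteq> N"
    and max: "\<And>P. prime_of A P \<Longrightarrow> I \<subseteq> P \<Longrightarrow> A - N \<subseteq> A - P \<Longrightarrow> A - P = A - N"
    by auto
  show ?thesis
  proof (rule that[OF N])
    fix P assume P: "prime_of A P" "I \<subseteq> P" "P \<subseteq> N"
    hence "A - P = A - N" using max[of P] by auto
    thus "P = N" using sub[OF P(1)] sub[OF N(1)] by blast
  qed
qed

lemma field_inverse:
  assumes "x \<in> carrier R" "x \<noteq> \<zero>"
  shows "inv x \<in> carrier R" "x \<otimes> inv x = \<one>" "inv x \<otimes> x = \<one>"
  using assms field_Units by (auto simp: Units_r_inv Units_l_inv)

lemma local_ideal_subset:
  assumes "local_of A M" "ideal_of A J" "\<one> \<notin> J"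
  shows "J \<subseteq> M"
proof
  fix x assume x: "x \<in> J"
  have M: "prime_of A M" using assms(1) by (simp add: local_of_def)
  show "x \<in> M"
  proof (rule ccontr)
    assume n: "x \<notin> M"
    hence i: "inv x \<in> A" using x ideal_subset[OF assms(2)] assms(1) by (auto simp: local_of_def)
    have "x \<in> carrier R" using x submodule_carrier[OF ideal_submodule[OF assms(2)]] by auto
    moreover have "x \<noteq> \<zero>" using n primeD(4)[OF M] by auto
    ultimately have "inv x \<otimes> x = \<one>" by (rule field_inverse)
    thus False using submodule_lmult[OF ideal_submodule[OF assms(2)] i x] assms(3) by simp
  qed
qed

section \<open>Localization at a prime ideal\<close>

lemma prime_complement_mult:
  assumes "subring A R" "prime_of A N" "s \<in> A - N" "t \<in> A - N"
  shows "s \<otimes> t \<in> A - N"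
  using assms subringE(6)[OF assms(1)] by (auto simp: prime_of_def)

lemma one_complement:
  assumes "subring A R" "prime_of A N"
  shows "\<one> \<in> A - N"
  using assms subringE(3)[OF assms(1)] by (auto simp: prime_of_def)

lemma submodule_localize:
  assumes "subring A R" "prime_of A N" "submodule_of A I"
  shows "submodule_of (localize A N A) (localize A N I)"
  unfolding submodule_of_def
proof (intro conjI ballI)
  note A = subringE[OF assms(1)]
  have Ac: "x \<in> carrier R" if "x \<in> A" for x using that A(1) by auto
  have Ic: "x \<in> carrier R" if "x \<in> I" for x using that submodule_carrier[OF assms(3)] by auto
  show "localize A N I \<subseteq> carrier R" by (auto simp: localize_def)
  show "\<zero> \<in> localize A N I"
    using one_complement[OF assms(1,2)] submodule_zero[OF assms(3)] by (auto simp: localize_def intro!: bexI[of _ \<one>])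
  fix x assume "x \<in> localize A N I"
  then obtain s where s: "s \<in> A - N" "s \<otimes> x \<in> I" and xc: "x \<in> carrier R" by (auto simp: localize_def)
  { fix y assume "y \<in> localize A N I"
    then obtain t where t: "t \<in> A - N" "t \<otimes> y \<in> I" and yc: "y \<in> carrier R" by (auto simp: localize_def)
    have "(s \<otimes> t) \<otimes> (x \<oplus> y) = t \<otimes> (s \<otimes> x) \<oplus> s \<otimes> (t \<otimes> y)"
      using s t xc yc Ac by (simp add: ring_ac)
    also have "\<dots> \<in> I" using s t submodule_add[OF assms(3)] submodule_lmult[OF assms(3)] by auto
    finally show "x \<oplus> y \<in> localize A N I"
      using prime_complement_mult[OF assms(1,2) s(1) t(1)] xc yc by (auto simp: localize_def) }
  fix a assume "a \<in> localize A N A"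
  then obtain t where t: "t \<in> A - N" "t \<otimes> a \<in> A" and ac: "a \<in> carrier R" by (auto simp: localize_def)
  have "(s \<otimes> t) \<otimes> (a \<otimes> x) = (t \<otimes> a) \<otimes> (s \<otimes> x)"
    using s t xc ac Ac by (simp add: ring_ac)
  also have "\<dots> \<in> I" using s t submodule_lmult[OF assms(3)] by auto
  finally show "a \<otimes> x \<in> localize A N I"
    using prime_complement_mult[OF assms(1,2) s(1) t(1)] xc ac by (auto simp: localize_def)
qed

lemma localize_superset:
  assumes "subring A R" "prime_of A N" "I \<subseteq> A"
  shows "I \<subseteq> localize A N I"
proof
  fix x assume x: "x \<in> I"
  hence c: "x \<in> carrier R" using assms(3) subringE(1)[OF assms(1)] by blast
  hence "\<one> \<otimes> x \<in> I" using x by simp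
  thus "x \<in> localize A N I"
    using one_complement[OF assms(1,2)] c unfolding localize_def by blast
qed

lemma subring_localize:
  assumes "subring A R" "prime_of A N"
  shows "subring (localize A N A) R"
proof (rule subringI)
  note A = subringE[OF assms(1)]
  note sub = submodule_localize[OF assms subring_submodule[OF assms(1)]]
  note sup = localize_superset[OF assms subset_refl]
  show "localize A N A \<subseteq> carrier R" by (auto simp: localize_def)
  show "\<one> \<in> localize A N A" using A(3) sup by auto
  show "x \<otimes> y \<in> localize A N A" "x \<oplus> y \<in> localize A N A"
    if "x \<in> localize A N A" "y \<in> localize A N A" for x y
    by (rule submodule_lmult[OF sub that], rule submodule_add[OF sub that])
  show "\<ominus> x \<in> localize A N A" if "x \<in> localize A N A" for x
  proof -
    have "x \<in> carrier R" using that by (simp add: localize_def)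
    hence eq: "(\<ominus> \<one>) \<otimes> x = \<ominus> x" by (simp add: l_minus)
    have "\<ominus> \<one> \<in> localize A N A" using A(5)[OF A(3)] sup by blast
    from submodule_lmult[OF sub this that] show ?thesis unfolding eq .
  qed
qed

lemma localize_mono: "I \<subseteq> J \<Longrightarrow> localize A N I \<subseteq> localize A N J"
  by (auto simp: localize_def)

text \<open>The denominator of an element lies outside \<open>N\<close>, hence outside
  \<open>P\<close>, and primality removes it.\<close>

lemma localize_prime_contract:
  assumes "subring A R" "prime_of A P" "P \<subseteq> N"
  shows "localize A N P \<inter> A \<subseteq> P"
  using primeD(8)[OF assms(2)] assms(3) by (auto simp: localize_def)

lemma prime_localize:
  assumes "subring A R" "prime_of A N" "prime_of A P" "P \<subseteq> N"
  shows "prime_of (localize A N A) (localize A N P)"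
  unfolding prime_of_def ideal_of_def
proof (intro conjI ballI impI)
  note A = subringE[OF assms(1)]
  have Ac: "x \<in> carrier R" if "x \<in> A" for x using that A(1) by auto
  have P: "submodule_of A P" "P \<subseteq> A" using primeD(1,2)[OF assms(3)] ideal_submodule by auto
  show "submodule_of (localize A N A) (localize A N P)" by (rule submodule_localize[OF assms(1,2) P(1)])
  show "localize A N P \<subseteq> localize A N A" by (rule localize_mono[OF P(2)])
  show "\<one> \<notin> localize A N P"
    using localize_prime_contract[OF assms(1,3,4)] A(3) primeD(5)[OF assms(3)] by auto
  fix x y assume "x \<in> localize A N A" "y \<in> localize A N A"
  then obtain s t where st: "s \<in> A - N" "t \<in> A - N" "s \<otimes> x \<in> A" "t \<otimes> y \<in> A"
    and c: "x \<in> carrier R" "y \<in> carrier R" by (auto simp: localize_def)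
  assume "x \<otimes> y \<in> localize A N P"
  then obtain u where u: "u \<in> A - N" "u \<otimes> (x \<otimes> y) \<in> P" by (auto simp: localize_def)
  have "u \<otimes> ((s \<otimes> x) \<otimes> (t \<otimes> y)) = (s \<otimes> t) \<otimes> (u \<otimes> (x \<otimes> y))"
    using st u c Ac by (simp add: ring_ac)
  also have "\<dots> \<in> P" using submodule_lmult[OF P(1)] st u A(6) by auto
  finally have "u \<in> P \<or> s \<otimes> x \<in> P \<or> t \<otimes> y \<in> P"
    using primeD(8)[OF assms(3)] st u A(6) by blast
  hence "s \<otimes> x \<in> P \<or> t \<otimes> y \<in> P" using u assms(4) by auto
  thus "x \<in> localize A N P \<or> y \<in> localize A N P" using st c by (auto simp: localize_def)
qed

lemma local_localize:
  assumes "subring A R" "prime_of A N"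
  shows "local_of (localize A N A) (localize A N N)"
  unfolding local_of_def
proof (intro conjI ballI)
  show "prime_of (localize A N A) (localize A N N)"
    by (rule prime_localize[OF assms assms(2) subset_refl])
  fix x assume x: "x \<in> localize A N A - localize A N N"
  then obtain s where s: "s \<in> A - N" "s \<otimes> x \<in> A" and c: "x \<in> carrier R" by (auto simp: localize_def)
  have "s \<otimes> x \<notin> N" using x s c by (auto simp: localize_def)
  have "\<zero> \<in> N" using primeD(4)[OF assms(2)] .
  hence "x \<noteq> \<zero>" using \<open>s \<otimes> x \<notin> N\<close> s subringE(1)[OF assms(1)] by auto
  hence i: "inv x \<in> carrier R" "x \<otimes> inv x = \<one>" using field_inverse c by auto
  have "s \<otimes> x \<otimes> inv x = s"
    using s c i subringE(1)[OF assms(1)] by (auto simp: m_assoc)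
  thus "inv x \<in> localize A N A"
    using i \<open>s \<otimes> x \<notin> N\<close> s by (auto simp: localize_def intro!: bexI[of _ "s \<otimes> x"])
qed

text \<open>A denominator \<open>s\<close> of \<open>x\<close> lies in \<open>A : x\<close> and
  becomes a unit in the localization, so \<open>A : x\<close> extends to the unit ideal.\<close>

lemma flat_localize:
  assumes "subring A R" "prime_of A N"
  shows "flat_overring A (localize A N A)"
  unfolding flat_overring_def
proof (intro conjI ballI)
  show "subring (localize A N A) R" by (rule subring_localize[OF assms])
  show "A \<subseteq> localize A N A" by (rule localize_superset[OF assms subset_refl])
  fix x assume "x \<in> localize A N A"
  then obtain s where s: "s \<in> A - N" "s \<otimes> x \<in> A" by (auto simp: localize_def)
  have sc: "s \<in> carrier R" using s subringE(1)[OF assms(1)] by auto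
  have "\<zero> \<in> N" using primeD(4)[OF assms(2)] .
  hence "s \<noteq> \<zero>" using s by auto
  hence i: "inv s \<in> carrier R" "s \<otimes> inv s = \<one>" using field_inverse sc by auto
  hence "inv s \<in> localize A N A"
    using s subringE(3)[OF assms(1)] by (auto simp: localize_def intro!: bexI[of _ s])
  thus "\<one> \<in> colon A A x \<cdot> localize A N A"
    using i s ideal_prod.prod[of s "colon A A x" "inv s" "localize A N A" R] by (auto simp: colon_def)
qed

text \<open>An element missing from a radical ideal is avoided by some prime above it. Such a prime
  contracts to a prime of \<open>A\<close> between \<open>I\<close> and \<open>N\<close>, which is
  \<open>N\<close> by minimality; so no element of \<open>N\<close> can be missing from
  \<open>Q\<close>.\<close>

lemma semiprime_localize_minimal:
  assumes "subring A R" "prime_of A N" "I \<subseteq> A"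
    and min: "\<And>P. prime_of A P \<Longrightarrow> I \<subseteq> P \<Longrightarrow> P \<subseteq> N \<Longrightarrow> P = N"
    and Q: "semiprime_of (localize A N A) Q" "\<one> \<notin> Q" "I \<subseteq> Q"
  shows "Q = localize A N N"
proof
  let ?B = "localize A N A" and ?M = "localize A N N"
  note B = subring_localize[OF assms(1,2)]
  note AB = localize_superset[OF assms(1,2) subset_refl]
  note A = subringE[OF assms(1)]
  have loc: "local_of ?B ?M" by (rule local_localize[OF assms(1,2)])
  note sub = local_ideal_subset[OF loc]
  show "Q \<subseteq> ?M" using sub Q by (auto simp: semiprime_of_def)
  show "?M \<subseteq> Q"
  proof
    fix x assume "x \<in> ?M"
    then obtain s where s: "s \<in> A - N" "s \<otimes> x \<in> N" and xc: "x \<in> carrier R" by (auto simp: localize_def)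
    have NA: "N \<subseteq> A" using primeD(2)[OF assms(2)] .
    have "s \<otimes> x \<in> Q"
    proof (rule ccontr)
      assume n: "s \<otimes> x \<notin> Q"
      have "s \<otimes> x \<in> ?B" using s NA AB by auto
      then obtain P where P: "prime_of ?B P" "Q \<subseteq> P" "s \<otimes> x \<notin> P"
        using prime_avoiding[OF B Q(1) _ n] by metis
      have PM: "P \<subseteq> ?M" using P sub by (auto simp: prime_of_def)
      have "prime_of A (P \<inter> A)" by (rule prime_contract[OF assms(1) AB P(1)])
      moreover have "P \<inter> A \<subseteq> N" using PM localize_prime_contract[OF assms(1,2) subset_refl] by auto
      ultimately have "P \<inter> A = N" using min[of "P \<inter> A"] Q(3) P(2) assms(3) by auto
      thus False using P s by auto
    qed
    have sc: "s \<in> carrier R" using s A by auto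
    have "\<zero> \<in> N" using primeD(4)[OF assms(2)] .
    hence "s \<noteq> \<zero>" using s by auto
    hence i: "inv s \<in> carrier R" "s \<otimes> inv s = \<one>" "inv s \<otimes> s = \<one>"
      using field_inverse sc by auto
    hence "inv s \<in> ?B" using s A by (auto simp: localize_def intro!: bexI[of _ s])
    hence "inv s \<otimes> (s \<otimes> x) \<in> Q"
      using Q(1) \<open>s \<otimes> x \<in> Q\<close> submodule_lmult by (auto simp: semiprime_of_def ideal_of_def)
    moreover have "inv s \<otimes> (s \<otimes> x) = x" using i sc xc by (simp flip: m_assoc)
    ultimately show "x \<in> Q" by simp
  qed
qed

section \<open>Flat overrings\<close>

lemma flatD:
  assumes "flat_overring A B"
  shows "subring B R" "A \<subseteq> B" "\<And>x. x \<in> B \<Longrightarrow> \<one> \<in> colon A A x \<cdot> B"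
  using assms by (auto simp: flat_overring_def)

lemma submodule_extend:
  assumes "subring B R" "I \<subseteq> carrier R" "\<zero> \<in> I"
  shows "submodule_of B (I \<cdot> B)"
  unfolding submodule_of_def
proof (intro conjI ballI)
  note B = subringE[OF assms(1)]
  show sub: "I \<cdot> B \<subseteq> carrier R" by (rule ideal_prod_closed[OF assms(2) B(1)])
  show "\<zero> \<in> I \<cdot> B" using ideal_prod.prod[OF assms(3) B(2), of R] by simp
  show "x \<oplus> y \<in> I \<cdot> B" if "x \<in> I \<cdot> B" "y \<in> I \<cdot> B" for x y by (rule ideal_prod.sum[OF that])
  show "b \<otimes> x \<in> I \<cdot> B" if b: "b \<in> B" and "x \<in> I \<cdot> B" for b x
    using that(2)
  proof induct
    case (prod i j)
    have c: "b \<in> carrier R" "i \<in> carrier R" "j \<in> carrier R" using b prod assms(2) B(1) by auto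
    have "i \<otimes> (b \<otimes> j) \<in> I \<cdot> B" using prod B(6)[OF b] by (auto intro: ideal_prod.prod)
    thus ?case using c by (simp add: m_lcomm)
  next
    case (sum x y)
    have "b \<in> carrier R" "x \<in> carrier R" "y \<in> carrier R" using b sum sub B(1) by auto
    hence "b \<otimes> (x \<oplus> y) = b \<otimes> x \<oplus> b \<otimes> y" by (simp add: r_distr)
    thus ?case using sum by (auto intro: ideal_prod.sum)
  qed
qed

lemma extend_superset:
  assumes "subring B R" "I \<subseteq> carrier R"
  shows "I \<subseteq> I \<cdot> B"
proof
  fix x assume "x \<in> I"
  thus "x \<in> I \<cdot> B"
    using ideal_prod.prod[of x I \<one> B R] subringE(3)[OF assms(1)] assms(2) by auto
qed

lemma extend_subset:
  assumes "subring B R" "submodule_of B L" "I \<subseteq> L"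
  shows "I \<cdot> B \<subseteq> L"
  using ideal_prod_mono[OF assms(3) subset_refl] ideal_prod_unit[OF assms(1,2)] by blast

text \<open>Two denominator conditions are met at once: \<open>D \<cdot> B\<close> contains
  \<open>B\<close>, so \<open>C \<cdot> (D \<cdot> B)\<close> contains
  \<open>C \<cdot> B\<close>.\<close>

lemma one_in_prod_extend:
  assumes "subring B R" "C \<subseteq> carrier R" "D \<subseteq> carrier R" "\<zero> \<in> D"
    and "\<one> \<in> C \<cdot> B" "\<one> \<in> D \<cdot> B"
  shows "\<one> \<in> C \<cdot> D \<cdot> B"
proof -
  have s: "submodule_of B (D \<cdot> B)" by (rule submodule_extend[OF assms(1,3,4)])
  have "b \<in> D \<cdot> B" if "b \<in> B" for b
    using submodule_lmult[OF s that assms(6)] that subringE(1)[OF assms(1)] by auto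
  hence "C \<cdot> B \<subseteq> C \<cdot> (D \<cdot> B)" by (intro ideal_prod_mono) auto
  thus ?thesis using assms ideal_prod_assoc[of C D B] subringE(1)[OF assms(1)] by auto
qed

text \<open>Induction on how \<open>z\<close> is built. For \<open>q \<otimes> b\<close>, whatever
  moves \<open>b\<close> into \<open>A\<close> moves the product into \<open>Q\<close>. For a sum,
  the product of the two colon ideals moves both summands into \<open>Q\<close>.\<close>

lemma one_in_colon_extend:
  assumes "subring A R" "flat_overring A B" "ideal_of A Q" "z \<in> Q \<cdot> B"
  shows "\<one> \<in> colon A Q z \<cdot> B"
  using assms(4)
proof induct
  note A = subringE[OF assms(1)] and B = flatD[OF assms(2)]
  note Bc = subringE(1)[OF B(1)]
  note Q = ideal_submodule[OF assms(3)]
  note Qc = submodule_carrier[OF Q]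
  {
    case (prod q b)
    have c: "q \<in> carrier R" "b \<in> carrier R" using prod Qc Bc by auto
    have "colon A A b \<subseteq> colon A Q (q \<otimes> b)"
    proof
      fix a assume a: "a \<in> colon A A b"
      hence "a \<in> carrier R" using A(1) by (auto simp: colon_def)
      hence "a \<otimes> (q \<otimes> b) = (a \<otimes> b) \<otimes> q" using c by (simp add: m_assoc m_comm m_lcomm)
      moreover have "(a \<otimes> b) \<otimes> q \<in> Q" using a prod submodule_lmult[OF Q] by (auto simp: colon_def)
      ultimately show "a \<in> colon A Q (q \<otimes> b)" using a by (simp add: colon_def)
    qed
    thus ?case using ideal_prod_mono[OF _ subset_refl] B(3)[OF prod(2)] by blast
  next
    case (sum x y)
    have c: "x \<in> carrier R" "y \<in> carrier R" using sum ideal_prod_closed[OF Qc Bc] by auto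
    note X = ideal_colon[OF assms(1) Q c(1)] and Y = ideal_colon[OF assms(1) Q c(2)]
    have Xc: "colon A Q x \<subseteq> carrier R" "colon A Q y \<subseteq> carrier R"
      using A(1) by (auto simp: colon_def)
    have XY: "colon A Q x \<cdot> colon A Q y \<subseteq> colon A Q x" "colon A Q x \<cdot> colon A Q y \<subseteq> colon A Q y"
      using ideal_prod_subset_left[OF assms(1) ideal_submodule[OF X] ideal_subset[OF Y]]
        ideal_prod_subset_right[OF assms(1) ideal_submodule[OF Y] ideal_subset[OF X]] .
    have "colon A Q x \<cdot> colon A Q y \<subseteq> colon A Q (x \<oplus> y)"
    proof
      fix a assume "a \<in> colon A Q x \<cdot> colon A Q y"
      hence a: "a \<in> A" "a \<otimes> x \<in> Q" "a \<otimes> y \<in> Q" using XY by (auto simp: colon_def)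
      have "a \<in> carrier R" using a A(1) by auto
      hence "a \<otimes> (x \<oplus> y) = a \<otimes> x \<oplus> a \<otimes> y" using c by (simp add: r_distr)
      thus "a \<in> colon A Q (x \<oplus> y)" using a submodule_add[OF Q] by (simp add: colon_def)
    qed
    moreover have "\<one> \<in> colon A Q x \<cdot> colon A Q y \<cdot> B"
      using one_in_prod_extend[OF B(1) Xc] submodule_zero[OF ideal_submodule[OF Y]] sum by auto
    ultimately show ?case using ideal_prod_mono[OF _ subset_refl] by blast
  }
qed

text \<open>Writing \<open>\<one>\<close> as a sum of products \<open>a \<otimes> b\<close> with
  \<open>a \<otimes> x \<in> Q\<close> and multiplying by \<open>x\<close> exhibits \<open>x\<close>
  in the extension. Together with \<open>one_in_colon_extend\<close> this reduces membership in an
  extended ideal to colon ideals.\<close>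

lemma mem_extend_of_one_in_colon:
  assumes "subring A R" "subring B R" "submodule_of A Q" "x \<in> B" "\<one> \<in> colon A Q x \<cdot> B"
  shows "x \<in> Q \<cdot> B"
proof -
  note Qc = submodule_carrier[OF assms(3)] and B = subringE[OF assms(2)]
  note QB = submodule_extend[OF assms(2) Qc submodule_zero[OF assms(3)]]
  have xc: "x \<in> carrier R" using assms(4) B(1) by auto
  have "y \<otimes> x \<in> Q \<cdot> B" if "y \<in> colon A Q x \<cdot> B" for y
    using that
  proof induct
    case (prod a b)
    have c: "a \<in> carrier R" "b \<in> carrier R"
      using prod subringE(1)[OF assms(1)] B(1) by (auto simp: colon_def)
    have "(a \<otimes> x) \<otimes> b \<in> Q \<cdot> B" using prod by (auto simp: colon_def intro: ideal_prod.prod)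
    thus ?case using c xc by (simp add: m_assoc m_comm m_lcomm)
  next
    case (sum y z)
    have "y \<in> carrier R" "z \<in> carrier R"
      using sum ideal_prod_closed[OF _ B(1), of "colon A Q x"] subringE(1)[OF assms(1)]
      by (auto simp: colon_def)
    hence "(y \<oplus> z) \<otimes> x = y \<otimes> x \<oplus> z \<otimes> x" using xc by (simp add: l_distr)
    thus ?case using sum by (auto intro: ideal_prod.sum)
  qed
  from this[OF assms(5)] show ?thesis using xc by simp
qed

text \<open>
  For \<open>x \<otimes> x \<in> Q B\<close>, every product \<open>a \<otimes> c\<close> with \<open>a \<in> A : x\<close> and \<open>c \<in> Q : x \<otimes> x\<close> moves \<open>x\<close>
  into \<open>A\<close> with square in \<open>Q\<close>, hence into \<open>Q\<close>; and these products generate \<open>B\<close>.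
\<close>

lemma semiprime_extend:
  assumes "subring A R" "flat_overring A B" "semiprime_of A Q"
  shows "semiprime_of B (Q \<cdot> B)"
  unfolding semiprime_of_def
proof (intro conjI ballI impI)
  note A = subringE[OF assms(1)] and B = flatD[OF assms(2)]
  note Bc = subringE(1)[OF B(1)]
  have Qi: "ideal_of A Q" using assms(3) by (simp add: semiprime_of_def)
  note Q = ideal_submodule[OF Qi]
  note Qc = submodule_carrier[OF Q]
  have "Q \<cdot> B \<subseteq> B" using extend_subset[OF B(1) subring_submodule[OF B(1)]] ideal_subset[OF Qi] B(2) by auto
  thus "ideal_of B (Q \<cdot> B)"
    using submodule_extend[OF B(1) Qc submodule_zero[OF Q]] by (simp add: ideal_of_def)
  fix x assume x: "x \<in> B" and xx: "x \<otimes> x \<in> Q \<cdot> B"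
  have xc: "x \<in> carrier R" using x Bc by auto
  let ?C = "colon A A x" and ?D = "colon A Q (x \<otimes> x)"
  have D: "\<one> \<in> ?D \<cdot> B" by (rule one_in_colon_extend[OF assms(1,2) Qi xx])
  have CD: "?C \<subseteq> carrier R" "?D \<subseteq> carrier R" using A(1) by (auto simp: colon_def)
  have Di: "ideal_of A ?D" by (rule ideal_colon[OF assms(1) Q]) (use xc in auto)
  have "\<one> \<in> ?C \<cdot> ?D \<cdot> B"
    by (rule one_in_prod_extend[OF B(1) CD submodule_zero[OF ideal_submodule[OF Di]] B(3)[OF x] D])
  moreover have "?C \<cdot> ?D \<subseteq> colon A Q x"
  proof (rule ideal_prod_le)
    fix a d assume "a \<in> ?C" "d \<in> ?D"
    hence ad: "a \<in> A" "a \<otimes> x \<in> A" "d \<in> A" "d \<otimes> (x \<otimes> x) \<in> Q" by (auto simp: colon_def)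
    have c: "a \<in> carrier R" "d \<in> carrier R" using ad A(1) by auto
    have e: "a \<otimes> d \<otimes> x = d \<otimes> (a \<otimes> x)" using c xc by (simp add: m_assoc m_comm m_lcomm)
    have "(d \<otimes> (a \<otimes> x)) \<otimes> (d \<otimes> (a \<otimes> x)) = (a \<otimes> a \<otimes> d) \<otimes> (d \<otimes> (x \<otimes> x))"
      using c xc by (simp add: m_assoc m_comm m_lcomm)
    also have "\<dots> \<in> Q" using submodule_lmult[OF Q _ ad(4)] ad A(6) by blast
    finally have "d \<otimes> (a \<otimes> x) \<in> Q"
      using assms(3) A(6)[OF ad(3,2)] unfolding semiprime_of_def by blast
    thus "a \<otimes> d \<in> colon A Q x" using e A(6)[OF ad(1,3)] by (simp add: colon_def)
  qed (rule submodule_add[OF ideal_submodule[OF ideal_colon[OF assms(1) Q xc]]])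
  ultimately have "\<one> \<in> colon A Q x \<cdot> B" using ideal_prod_mono[OF _ subset_refl] by blast
  thus "x \<in> Q \<cdot> B" by (rule mem_extend_of_one_in_colon[OF assms(1) B(1) Q x])
qed

lemma ideal_contract:
  assumes "subring A R" "A \<subseteq> B" "ideal_of B I"
  shows "ideal_of A (I \<inter> A)"
  using assms(2,3) subringE(2,6,7)[OF assms(1)]
  by (simp add: ideal_of_def submodule_of_def subset_iff)

text \<open>For \<open>x \<in> I\<close>, an element of \<open>A\<close> that moves \<open>x\<close>
  into \<open>A\<close> moves it into \<open>I \<inter> A\<close>. So \<open>A : x\<close> equals
  \<open>(I \<inter> A) : x\<close>, and flatness applies.\<close>

lemma extend_contract:
  assumes "subring A R" "flat_overring A B" "ideal_of B I"
  shows "(I \<inter> A) \<cdot> B = I"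
proof
  note B = flatD[OF assms(2)]
  note I = ideal_submodule[OF assms(3)]
  show "(I \<inter> A) \<cdot> B \<subseteq> I" by (rule extend_subset[OF B(1) I]) auto
  note IA = ideal_submodule[OF ideal_contract[OF assms(1) B(2) assms(3)]]
  show "I \<subseteq> (I \<inter> A) \<cdot> B"
  proof
    fix x assume x: "x \<in> I"
    hence xB: "x \<in> B" using ideal_subset[OF assms(3)] by auto
    have "colon A A x \<subseteq> colon A (I \<inter> A) x"
      using submodule_lmult[OF I _ x] B(2) by (auto simp: colon_def)
    hence "\<one> \<in> colon A (I \<inter> A) x \<cdot> B"
      using ideal_prod_mono[OF _ subset_refl] B(3)[OF xB] by blast
    thus "x \<in> (I \<inter> A) \<cdot> B" by (rule mem_extend_of_one_in_colon[OF assms(1) B(1) IA xB])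
  qed
qed

lemma extend_prod:
  assumes "subring B R" "I \<subseteq> carrier R" "\<zero> \<in> J" "J \<subseteq> carrier R"
  shows "I \<cdot> J \<cdot> B = (I \<cdot> B) \<cdot> (J \<cdot> B)"
proof -
  note Bc = subringE(1)[OF assms(1)]
  have "(I \<cdot> B) \<cdot> (J \<cdot> B) = I \<cdot> (B \<cdot> (J \<cdot> B))"
    by (rule ideal_prod_assoc[OF assms(2) Bc ideal_prod_closed[OF assms(4) Bc]])
  also have "B \<cdot> (J \<cdot> B) = J \<cdot> B"
    by (rule ideal_prod_unit_left[OF assms(1) submodule_extend[OF assms(1,4,3)]])
  finally show ?thesis using ideal_prod_assoc[OF assms(2,4) Bc] by simp
qed

lemma extend_ideal_prods:
  assumes "subring A R" "subring B R" "A \<subseteq> B" "\<forall>Q\<in>set Qs. ideal_of A Q"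
  shows "ideal_prods A Qs \<cdot> B = ideal_prods B (map (\<lambda>Q. Q \<cdot> B) Qs)"
  using assms(4)
proof (induct Qs)
  case Nil
  note B = subringE[OF assms(2)]
  have "B \<subseteq> A \<cdot> B"
  proof
    fix b assume b: "b \<in> B"
    hence "\<one> \<otimes> b \<in> A \<cdot> B" by (rule ideal_prod.prod[OF subringE(3)[OF assms(1)]])
    thus "b \<in> A \<cdot> B" using b B(1) by auto
  qed
  hence "A \<cdot> B = B"
    using extend_subset[OF assms(2) subring_submodule[OF assms(2)] assms(3)] by blast
  thus ?case by simp
next
  case (Cons Q Qs)
  hence "ideal_of A (ideal_prods A Qs)" by (intro ideal_of_ideal_prods[OF assms(1)]) auto
  hence P: "submodule_of A (ideal_prods A Qs)" by (rule ideal_submodule)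
  have "Q \<subseteq> carrier R" using Cons by (auto simp: ideal_of_def submodule_of_def)
  hence "Q \<cdot> ideal_prods A Qs \<cdot> B = (Q \<cdot> B) \<cdot> (ideal_prods A Qs \<cdot> B)"
    by (rule extend_prod[OF assms(2) _ submodule_zero[OF P] submodule_carrier[OF P]])
  thus ?case using Cons by simp
qed

lemma ideal_prods_filter:
  assumes "subring B R" "\<forall>Q\<in>set Qs. ideal_of B Q"
  shows "ideal_prods B (filter (\<lambda>Q. \<one> \<notin> Q) Qs) = ideal_prods B Qs"
  using assms(2)
proof (induct Qs)
  case (Cons Q Qs)
  have s: "submodule_of B (ideal_prods B Qs)"
    by (rule ideal_submodule, rule ideal_of_ideal_prods[OF assms(1)]) (use Cons in auto)
  show ?case
  proof (cases "\<one> \<in> Q")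
    case True
    hence "Q = B" using one_in_ideal_iff[OF assms(1), of Q] Cons by auto
    thus ?thesis using Cons ideal_prod_unit_left[OF assms(1) s] True by simp
  qed (use Cons in simp)
qed simp

lemma invertible_extend:
  assumes "subring A R" "subring B R" "A \<subseteq> B" "invertible_of A J"
  shows "invertible_of B (J \<cdot> B)"
proof -
  obtain L where L: "submodule_of A L" "J \<cdot> L = A" and J: "ideal_of A J"
    using assms(4) by (auto simp: invertible_of_def)
  note Jc = submodule_carrier[OF ideal_submodule[OF J]] and Lc = submodule_carrier[OF L(1)]
  have "J \<cdot> L \<cdot> B = (J \<cdot> B) \<cdot> (L \<cdot> B)"
    by (rule extend_prod[OF assms(2) Jc submodule_zero[OF L(1)] Lc])
  moreover have "A \<cdot> B = B"
    using extend_ideal_prods[OF assms(1-3), of "[]"] by simp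
  ultimately have "(J \<cdot> B) \<cdot> (L \<cdot> B) = B" using L by simp
  moreover have "submodule_of B (J \<cdot> B)" "submodule_of B (L \<cdot> B)"
    using submodule_extend[OF assms(2) Jc submodule_zero[OF ideal_submodule[OF J]]]
      submodule_extend[OF assms(2) Lc submodule_zero[OF L(1)]] .
  moreover have "J \<cdot> B \<subseteq> B"
    using extend_subset[OF assms(2) subring_submodule[OF assms(2)]] ideal_subset[OF J] assms(3) by auto
  ultimately show ?thesis unfolding invertible_of_def ideal_of_def by blast
qed

section \<open>Transfer of the ISP property to flat overrings\<close>

lemma ispD:
  assumes "isp A"
  shows "subring A R" "\<And>x. x \<in> carrier R \<Longrightarrow> \<exists>b\<in>A. b \<noteq> \<zero> \<and> b \<otimes> x \<in> A"
  using assms by (auto simp: isp_def)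

lemma isp_factor:
  assumes "isp A" "ideal_of A I" "\<one> \<notin> I" "x \<in> I" "x \<noteq> \<zero>"
  obtains J Qs where "invertible_of A J" "Qs \<noteq> []" "\<And>Q. Q \<in> set Qs \<Longrightarrow> semiprime_of A Q"
    "\<And>Q. Q \<in> set Qs \<Longrightarrow> \<one> \<notin> Q" "I = J \<cdot> ideal_prods A Qs"
proof -
  have "I \<noteq> {\<zero>}" using assms by auto
  thus ?thesis using assms(1-3) that unfolding isp_def by blast
qed

text \<open>Multiplying by the inverse of \<open>J\<close> turns
  \<open>J \<subseteq> J \<cdot> E\<close> into \<open>A \<subseteq> E\<close>.\<close>

lemma invertible_cancel:
  assumes "subring A R" "invertible_of A J" "ideal_of A E" "J \<subseteq> J \<cdot> E"
  shows "E = A"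
proof -
  obtain L where L: "submodule_of A L" "J \<cdot> L = A" and J: "ideal_of A J"
    using assms(2) by (auto simp: invertible_of_def)
  note Jc = submodule_carrier[OF ideal_submodule[OF J]] and Lc = submodule_carrier[OF L(1)]
    and Ec = submodule_carrier[OF ideal_submodule[OF assms(3)]]
  have "A \<subseteq> J \<cdot> E \<cdot> L" using ideal_prod_mono[OF assms(4) subset_refl] L by metis
  also have "\<dots> = J \<cdot> L \<cdot> E"
    using ideal_prod_assoc[OF Jc Ec Lc] ideal_prod_assoc[OF Jc Lc Ec] ideal_prod_comm[OF Ec Lc] by simp
  also have "\<dots> = E" using L ideal_prod_unit_left[OF assms(1) ideal_submodule[OF assms(3)]] by simp
  finally show ?thesis using ideal_subset[OF assms(3)] by auto
qed

theorem isp_flat_overring: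
  assumes "isp A" "flat_overring A B"
  shows "isp B"
  unfolding isp_def
proof (intro conjI ballI allI impI)
  note A = ispD[OF assms(1)] and B = flatD[OF assms(2)]
  note AE = subringE[OF A(1)] and Bc = subringE(1)[OF B(1)]
  show "subring B R" by (rule B(1))
  show "\<exists>b\<in>B. b \<noteq> \<zero> \<and> b \<otimes> x \<in> B" if "x \<in> carrier R" for x using A(2)[OF that] B(2) by blast
  fix I assume "ideal_of B I \<and> \<one> \<notin> I \<and> I \<noteq> {\<zero>}"
  hence I: "ideal_of B I" "\<one> \<notin> I" "I \<noteq> {\<zero>}" by auto
  note Is = ideal_submodule[OF I(1)]
  obtain x where x: "x \<in> I" "x \<noteq> \<zero>" using I(3) submodule_zero[OF Is] by auto
  have xc: "x \<in> carrier R" using x submodule_carrier[OF Is] by auto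
  \<comment> \<open>Clearing the denominator of a nonzero element of \<open>I\<close> shows that the
    contraction is nonzero, so it has a factorization.\<close>
  then obtain b where b: "b \<in> A" "b \<noteq> \<zero>" "b \<otimes> x \<in> A" using A(2) by auto
  have bx: "b \<otimes> x \<in> I \<inter> A" using b x B(2) submodule_lmult[OF Is] by auto
  have bx0: "b \<otimes> x \<noteq> \<zero>" using b x xc AE(1) integral_iff by auto
  have IA: "ideal_of A (I \<inter> A)" by (rule ideal_contract[OF A(1) B(2) I(1)])
  have "\<one> \<notin> I \<inter> A" using I by auto
  from isp_factor[OF assms(1) IA this bx bx0]
  obtain J Qs where JQ: "invertible_of A J" "Qs \<noteq> []" "\<And>Q. Q \<in> set Qs \<Longrightarrow> semiprime_of A Q"
    "\<And>Q. Q \<in> set Qs \<Longrightarrow> \<one> \<notin> Q" and eq: "I \<inter> A = J \<cdot> ideal_prods A Qs" by metis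
  have Ji: "ideal_of A J" using JQ(1) by (simp add: invertible_of_def)
  note Jc = submodule_carrier[OF ideal_submodule[OF Ji]]
  have Qi: "\<forall>Q\<in>set Qs. ideal_of A Q" using JQ(3) by (auto simp: semiprime_of_def)
  note P = ideal_of_ideal_prods[OF A(1) Qi]
  define Rs where "Rs = map (\<lambda>Q. Q \<cdot> B) Qs"
  define Ts where "Ts = filter (\<lambda>Q. \<one> \<notin> Q) Rs"
  have Rs: "\<forall>Q\<in>set Rs. semiprime_of B Q"
    unfolding Rs_def using semiprime_extend[OF A(1) assms(2)] JQ(3) by auto
  have "I = J \<cdot> ideal_prods A Qs \<cdot> B" using extend_contract[OF A(1) assms(2) I(1)] eq by simp
  also have "\<dots> = (J \<cdot> B) \<cdot> (ideal_prods A Qs \<cdot> B)"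
    by (rule extend_prod[OF B(1) Jc submodule_zero[OF ideal_submodule[OF P]] submodule_carrier[OF ideal_submodule[OF P]]])
  also have "ideal_prods A Qs \<cdot> B = ideal_prods B Rs"
    unfolding Rs_def by (rule extend_ideal_prods[OF A(1) B(1,2) Qi])
  also have "\<dots> = ideal_prods B Ts"
    unfolding Ts_def using ideal_prods_filter[OF B(1)] Rs by (auto simp: semiprime_of_def)
  finally have I_eq: "I = (J \<cdot> B) \<cdot> ideal_prods B Ts" .
  have JB: "invertible_of B (J \<cdot> B)" by (rule invertible_extend[OF A(1) B(1,2) JQ(1)])
  have "Ts \<noteq> []"
  proof
    assume "Ts = []"
    moreover have "submodule_of B (J \<cdot> B)"
      using JB by (auto simp: invertible_of_def ideal_of_def)
    ultimately have "I = J \<cdot> B" using I_eq ideal_prod_unit[OF B(1)] by simp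
    hence "J \<subseteq> J \<cdot> ideal_prods A Qs"
      using extend_superset[OF B(1) Jc] ideal_subset[OF Ji] eq by auto
    hence PA: "ideal_prods A Qs = A" by (rule invertible_cancel[OF A(1) JQ(1) P])
    obtain Q Qs' where Q: "Qs = Q # Qs'" using JQ(2) by (cases Qs) auto
    have "ideal_of A (ideal_prods A Qs')" using Qi Q by (intro ideal_of_ideal_prods[OF A(1)]) auto
    hence "ideal_prods A Qs \<subseteq> Q"
      using ideal_prod_subset_left[OF A(1), of Q] Qi Q by (simp add: ideal_of_def)
    thus False using PA JQ(4)[of Q] Q AE(3) by auto
  qed
  moreover have "\<forall>Q\<in>set Ts. semiprime_of B Q \<and> \<one> \<notin> Q" using Rs by (auto simp: Ts_def)
  ultimately show "\<exists>J Qs. invertible_of B J \<and> Qs \<noteq> [] \<and>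
      (\<forall>Q\<in>set Qs. semiprime_of B Q \<and> \<one> \<notin> Q) \<and> I = J \<cdot> ideal_prods B Qs"
    using JB I_eq by blast
qed

section \<open>Local ISP-domains\<close>

lemma localD:
  assumes "local_of A M"
  shows "prime_of A M" "ideal_of A M" "submodule_of A M" "M \<subseteq> A" "\<one> \<notin> M"
  using assms primeD[of A M] by (auto simp: local_of_def ideal_of_def)

lemma local_one_minus:
  assumes "subring A R" "local_of A M" "x \<in> M"
  shows "\<one> \<ominus> x \<in> A" "\<one> \<ominus> x \<notin> M"
proof -
  note A = subringE[OF assms(1)] and M = localD[OF assms(2)]
  show "\<one> \<ominus> x \<in> A"
    using submodule_diff[OF assms(1) subring_submodule[OF assms(1)] A(3)] M assms(3) by auto
  have c: "x \<in> carrier R" using assms(3) M A by auto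
  have "(\<one> \<ominus> x) \<oplus> x = \<one>" using c unfolding minus_eq by (simp add: a_assoc l_neg)
  thus "\<one> \<ominus> x \<notin> M" using submodule_add[OF M(3) _ assms(3)] M(5) by metis
qed

text \<open>The products \<open>j \<otimes> l\<close> cannot all lie in \<open>M\<close>, so one of
  them is a unit with inverse \<open>u\<close>. Then every \<open>x \<in> J\<close> is
  \<open>j\<close> times \<open>x \<otimes> l \<otimes> u\<close>, an element of
  \<open>A\<close>.\<close>

lemma invertible_local_principal:
  assumes "subring A R" "local_of A M" "J \<subseteq> carrier R" "submodule_of A J" "submodule_of A L" "J \<cdot> L = A"
  obtains j where "j \<in> J" "J = principal A j"
proof -
  note A = subringE[OF assms(1)] and M = localD[OF assms(2)] and Lc = submodule_carrier[OF assms(5)]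
  have "\<exists>j\<in>J. \<exists>l\<in>L. j \<otimes> l \<notin> M"
  proof (rule ccontr)
    assume "\<not> ?thesis"
    hence "J \<cdot> L \<subseteq> M" by (intro ideal_prod_le submodule_add[OF M(3)]) auto
    thus False using assms(6) A(3) M(5) by auto
  qed
  then obtain j l where jl: "j \<in> J" "l \<in> L" "j \<otimes> l \<notin> M" by auto
  have JL: "x \<otimes> y \<in> A" if "x \<in> J" "y \<in> L" for x y
    using ideal_prod.prod[OF that, of R] assms(6) by auto
  define u where "u = inv (j \<otimes> l)"
  have jlA: "j \<otimes> l \<in> A" by (rule JL[OF jl(1,2)])
  have c: "j \<in> carrier R" "l \<in> carrier R" using jl assms(3) Lc by auto
  have "j \<otimes> l \<noteq> \<zero>" using jl(3) submodule_zero[OF M(3)] by auto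
  hence u: "u \<in> carrier R" "j \<otimes> l \<otimes> u = \<one>"
    using field_inverse[of "j \<otimes> l"] c by (auto simp: u_def)
  have uA: "u \<in> A" using jlA jl(3) assms(2) by (auto simp: u_def local_of_def)
  have "x \<in> principal A j" if x: "x \<in> J" for x
  proof -
    have xc: "x \<in> carrier R" using x assms(3) by auto
    have "j \<otimes> (x \<otimes> l \<otimes> u) = x \<otimes> (j \<otimes> l \<otimes> u)"
      using c u(1) xc by (simp add: m_assoc m_comm m_lcomm)
    hence "x = j \<otimes> (x \<otimes> l \<otimes> u)" using u xc by simp
    moreover have "x \<otimes> l \<otimes> u \<in> A" using JL[OF x jl(2)] uA A(6) by auto
    ultimately show ?thesis by (auto simp: principal_def)
  qed
  hence "J = principal A j" using principal_subset[OF assms(4) A(1) jl(1)] by auto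
  thus ?thesis using that jl by auto
qed

lemma ideal_prods_subset_factor:
  assumes "subring A R" "\<And>Q. Q \<in> set Qs \<Longrightarrow> ideal_of A Q" "Q \<in> set Qs"
  shows "ideal_prods A Qs \<subseteq> Q"
  using assms(2,3)
proof (induct Qs)
  case (Cons H Qs)
  have H: "ideal_of A H" using Cons by auto
  have P: "ideal_of A (ideal_prods A Qs)"
    by (rule ideal_of_ideal_prods[OF assms(1)]) (use Cons in auto)
  show ?case
  proof (cases "Q = H")
    case True
    thus ?thesis
      using ideal_prod_subset_left[OF assms(1) ideal_submodule[OF H] ideal_subset[OF P]] by simp
  next
    case False
    hence "ideal_prods A Qs \<subseteq> Q" using Cons by auto
    thus ?thesis
      using ideal_prod_subset_right[OF assms(1) ideal_submodule[OF P] ideal_subset[OF H]] by auto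
  qed
qed simp

lemma factor_subset:
  assumes "subring A R" "ideal_of A J" "\<And>Q. Q \<in> set Qs \<Longrightarrow> ideal_of A Q" "Q \<in> set Qs"
  shows "J \<cdot> ideal_prods A Qs \<subseteq> Q"
proof -
  have P: "ideal_of A (ideal_prods A Qs)"
    by (rule ideal_of_ideal_prods[OF assms(1)]) (use assms(3) in auto)
  show ?thesis
    using ideal_prod_subset_right[OF assms(1) ideal_submodule[OF P] ideal_subset[OF assms(2)]]
      ideal_prods_subset_factor[OF assms(1,3,4)] by auto
qed

lemma ideal_prods_replicate_idempotent:
  assumes "subring A R" "submodule_of A M" "M \<cdot> M = M" "Qs \<noteq> []" "\<And>Q. Q \<in> set Qs \<Longrightarrow> Q = M"
  shows "ideal_prods A Qs = M"
  using assms(4,5)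
proof (induct Qs)
  case (Cons H Qs)
  show ?case
  proof (cases "Qs = []")
    case True
    thus ?thesis using Cons ideal_prod_unit[OF assms(1,2)] by simp
  next
    case False
    have "H = M" using Cons by simp
    hence "H \<cdot> M = M" using assms(3) by simp
    moreover have "ideal_prods A Qs = M" using Cons False by simp
    ultimately show ?thesis by simp
  qed
qed simp

text \<open>
  For \<open>c \<in> M\<close> outside \<open>M\<^sup>2\<close> the factorization of an ideal \<open>(c, a\<^sup>2)\<close> has a single factor, so
  that ideal is radical and contains \<open>a\<close>; as \<open>a \<in> M\<close>, this means \<open>a \<in> (c)\<close>.
\<close>

lemma local_isp_generator:
  assumes "isp A" "local_of A M" "c \<in> M" "c \<notin> M \<cdot> M"
  shows "M = principal A c"
proof
  note A1 = ispD(1)[OF assms(1)]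
  note A = subringE[OF A1] and M = localD[OF assms(2)]
  note Mc = submodule_carrier[OF M(3)]
  have c: "c \<in> carrier R" "c \<in> A" using assms(3) Mc M(4) by auto
  show "principal A c \<subseteq> M" by (rule principal_subset[OF M(3) A(1) assms(3)])
  show "M \<subseteq> principal A c"
  proof
    fix a assume a: "a \<in> M"
    have ac: "a \<in> carrier R" "a \<in> A" using a Mc M(4) by auto
    define I where "I = principal A c <+>\<^bsub>R\<^esub> principal A (a \<otimes> a)"
    have s1: "ideal_of A (principal A c)" "ideal_of A (principal A (a \<otimes> a))"
      using ideal_principal[OF A1] c ac A(6) by auto
    have I: "ideal_of A I" unfolding I_def by (rule ideal_set_add[OF A1 s1])
    note sup = set_add_supersets[OF ideal_submodule[OF s1(1)] ideal_submodule[OF s1(2)], folded I_def]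
    have cI: "c \<in> I" using sup(1) principal_self[OF A1 c(1)] by auto
    have aI: "a \<otimes> a \<in> I" using sup(2) principal_self[OF A1, of "a \<otimes> a"] ac by auto
    have aaM: "a \<otimes> a \<in> M" using submodule_lmult[OF M(3) ac(2) a] .
    have IM: "I \<subseteq> M" unfolding I_def
      by (intro set_add_least[OF M(3)] principal_subset[OF M(3) A(1)] assms(3) aaM)
    have "\<one> \<notin> I" using IM M(5) by auto
    moreover have "\<zero> \<in> M \<cdot> M"
      using submodule_zero[OF submodule_ideal_prod[OF A(1) M(3) M(3)]] .
    hence "c \<noteq> \<zero>" using assms(4) by auto
    ultimately obtain J Qs where JQ: "invertible_of A J" "Qs \<noteq> []"
      "\<And>Q. Q \<in> set Qs \<Longrightarrow> semiprime_of A Q" "\<And>Q. Q \<in> set Qs \<Longrightarrow> \<one> \<notin> Q"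
      and eq: "I = J \<cdot> ideal_prods A Qs"
      using isp_factor[OF assms(1) I _ cI] by metis
    have J: "ideal_of A J" using JQ(1) by (simp add: invertible_of_def)
    have Qi: "ideal_of A Q" if "Q \<in> set Qs" for Q using JQ(3)[OF that] by (simp add: semiprime_of_def)
    have QM: "Q \<subseteq> M" if "Q \<in> set Qs" for Q
      by (rule local_ideal_subset[OF assms(2) Qi[OF that] JQ(4)[OF that]])
    have PM: "ideal_prods A Rs \<subseteq> M" if Rs: "Rs \<noteq> []" "set Rs \<subseteq> set Qs" for Rs
    proof -
      obtain H where H: "H \<in> set Rs" using Rs(1) by (cases Rs) auto
      show ?thesis using ideal_prods_subset_factor[OF A1 Qi H] Rs(2) QM[of H] H by blast
    qed
    \<comment> \<open>A proper \<open>J\<close> here, or a second radical factor below, would put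
      \<open>I\<close> and with it \<open>c\<close> into \<open>M \<cdot> M\<close>.\<close>
    have "\<one> \<in> J"
    proof (rule ccontr)
      assume "\<one> \<notin> J"
      hence "J \<subseteq> M" by (rule local_ideal_subset[OF assms(2) J])
      hence "I \<subseteq> M \<cdot> M" unfolding eq by (intro ideal_prod_mono PM[OF JQ(2)]) auto
      thus False using cI assms(4) by auto
    qed
    hence JA: "J = A" using one_in_ideal_iff[OF A1 J] by simp
    obtain Q Rs where QR: "Qs = Q # Rs" using JQ(2) by (cases Qs) auto
    have P: "ideal_of A (ideal_prods A Qs)"
      by (rule ideal_of_ideal_prods[OF A1]) (use Qi in auto)
    have IP: "I = Q \<cdot> ideal_prods A Rs"
      using eq JA ideal_prod_unit_left[OF A1 ideal_submodule[OF P]] QR by simp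
    have "Rs = []"
    proof (rule ccontr)
      assume "Rs \<noteq> []"
      hence "I \<subseteq> M \<cdot> M" unfolding IP by (intro ideal_prod_mono PM) (use QR QM in auto)
      thus False using cI assms(4) by auto
    qed
    hence "I = Q" using IP ideal_prod_unit[OF A1 ideal_submodule[OF Qi]] QR by simp
    hence "a \<in> I" using JQ(3)[of Q] QR aI ac(2) by (auto simp: semiprime_of_def)
    then obtain r s where rs: "r \<in> A" "s \<in> A" "a = c \<otimes> r \<oplus> a \<otimes> a \<otimes> s"
      by (auto simp: I_def set_add_def' principal_def)
    have rc: "r \<in> carrier R" "s \<in> carrier R" using rs A(1) by auto
    have asM: "a \<otimes> s \<in> M" by (rule submodule_rmult[OF M(3) A(1) rs(2) a])
    \<comment> \<open>The relation for \<open>a\<close> reads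
      \<open>a \<otimes> u = c \<otimes> r\<close>, and \<open>u\<close> is a unit because
      \<open>a \<otimes> s \<in> M\<close>.\<close>
    define u where "u = \<one> \<ominus> a \<otimes> s"
    have u: "u \<in> A" "u \<notin> M" using local_one_minus[OF A1 assms(2) asM] by (auto simp: u_def)
    have uc: "u \<in> carrier R" using u A(1) by auto
    have "a \<otimes> u = a \<ominus> a \<otimes> a \<otimes> s"
      unfolding u_def minus_eq using ac rc by (simp add: r_distr r_minus m_assoc)
    also have "\<dots> = c \<otimes> r"
    proof -
      have "a \<ominus> a \<otimes> a \<otimes> s = (c \<otimes> r \<oplus> a \<otimes> a \<otimes> s) \<ominus> a \<otimes> a \<otimes> s" using rs(3) by simp
      also have "\<dots> = c \<otimes> r" unfolding minus_eq using ac c rc by (simp add: a_assoc r_neg)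
      finally show ?thesis .
    qed
    finally have au: "a \<otimes> u = c \<otimes> r" .
    have iu: "inv u \<in> A" using u assms(2) by (auto simp: local_of_def)
    have "u \<noteq> \<zero>" using u(2) submodule_zero[OF M(3)] by auto
    note ui = field_inverse[OF uc this]
    have "a = a \<otimes> u \<otimes> inv u" using ac uc ui by (simp add: m_assoc)
    hence "a = c \<otimes> (r \<otimes> inv u)" using au c rc ui by (simp add: m_assoc)
    moreover have "r \<otimes> inv u \<in> A" using A(6)[OF rs(1) iu] .
    ultimately show "a \<in> principal A c" by (auto simp: principal_def)
  qed
qed

text \<open>
  If \<open>M = M\<^sup>2\<close>, then \<open>P + (d) = j M\<close>; cancelling \<open>j \<notin> P\<close> gives \<open>M = P + (e)\<close> for some \<open>e\<close>,
  and squaring gives \<open>e \<in> P + (e\<^sup>2)\<close>, which forces \<open>e \<in> P\<close>.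
\<close>

lemma local_isp_not_idempotent:
  assumes "isp A" "local_of A M" "prime_of A P" "d \<in> M" "d \<notin> P"
    and rad: "\<And>Q. semiprime_of A Q \<Longrightarrow> \<one> \<notin> Q \<Longrightarrow> insert d P \<subseteq> Q \<Longrightarrow> Q = M"
  shows "\<not> M \<subseteq> M \<cdot> M"
proof
  assume idem: "M \<subseteq> M \<cdot> M"
  note A1 = ispD(1)[OF assms(1)]
  note A = subringE[OF A1] and M = localD[OF assms(2)] and P = primeD[OF assms(3)]
  note Mc = submodule_carrier[OF M(3)] and Ps = ideal_submodule[OF P(1)]
  have MM: "M \<cdot> M = M" using idem ideal_prod_subset_left[OF A1 M(3,4)] by auto
  have PM: "P \<subseteq> M" by (rule local_ideal_subset[OF assms(2) P(1,5)])
  have d: "d \<in> A" "d \<in> carrier R" using assms(4) M(4) Mc by auto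
  define I where "I = P <+>\<^bsub>R\<^esub> principal A d"
  note sd = ideal_principal[OF A1 d(1)]
  have I: "ideal_of A I" unfolding I_def by (rule ideal_set_add[OF A1 P(1) sd])
  note sup = set_add_supersets[OF Ps ideal_submodule[OF sd], folded I_def]
  have dI: "d \<in> I" using sup(2) principal_self[OF A1 d(2)] by auto
  have IM: "I \<subseteq> M" unfolding I_def
    by (intro set_add_least[OF M(3) PM] principal_subset[OF M(3) A(1) assms(4)])
  have "\<one> \<notin> I" using IM M(5) by auto
  moreover have "d \<noteq> \<zero>" using assms(5) P(4) by auto
  ultimately obtain J Qs where JQ: "invertible_of A J" "Qs \<noteq> []"
    "\<And>Q. Q \<in> set Qs \<Longrightarrow> semiprime_of A Q" "\<And>Q. Q \<in> set Qs \<Longrightarrow> \<one> \<notin> Q"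
    and eq: "I = J \<cdot> ideal_prods A Qs"
    using isp_factor[OF assms(1) I _ dI] by metis
  have J: "ideal_of A J" using JQ(1) by (simp add: invertible_of_def)
  note Js = ideal_submodule[OF J]
  have Qi: "ideal_of A Q" if "Q \<in> set Qs" for Q using JQ(3)[OF that] by (simp add: semiprime_of_def)
  \<comment> \<open>Each factor contains \<open>I\<close>, hence \<open>P\<close> and
    \<open>d\<close>, so it is \<open>M\<close>; idempotence then collapses the whole product to one
    copy of \<open>M\<close>.\<close>
  have "Q = M" if Q: "Q \<in> set Qs" for Q
    using rad[OF JQ(3)[OF Q] JQ(4)[OF Q]] factor_subset[OF A1 J Qi Q] eq dI sup(1) by auto
  hence IJM: "I = J \<cdot> M"
    using ideal_prods_replicate_idempotent[OF A1 M(3) MM JQ(2)] eq by simp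
  obtain L where L: "submodule_of A L" "J \<cdot> L = A" using JQ(1) by (auto simp: invertible_of_def)
  obtain j where j: "j \<in> J" "J = principal A j"
    by (rule invertible_local_principal[OF A1 assms(2) submodule_carrier[OF Js] Js L])
  have jc: "j \<in> carrier R" "j \<in> A" using j(1) submodule_carrier[OF Js] ideal_subset[OF J] by auto
  have I_image: "I = (\<lambda>n. j \<otimes> n) ` M"
    using IJM j(2) principal_prod_submodule[OF A1 jc(1) M(3)] by simp
  have jP: "j \<notin> P"
  proof
    assume "j \<in> P"
    hence "I \<subseteq> P" unfolding I_image using submodule_rmult[OF Ps A(1)] M(4) by auto
    thus False using dI assms(5) by auto
  qed
  obtain e where e: "e \<in> M" "d = j \<otimes> e" using dI I_image by auto
  have ec: "e \<in> carrier R" "e \<in> A" using e Mc M(4) by auto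
  have M_sub: "M \<subseteq> P <+>\<^bsub>R\<^esub> principal A e"
  proof
    fix n assume n: "n \<in> M"
    have nc: "n \<in> carrier R" "n \<in> A" using n Mc M(4) by auto
    have "j \<otimes> n \<in> I" using n I_image by auto
    then obtain p r where pr: "p \<in> P" "r \<in> A" "j \<otimes> n = p \<oplus> d \<otimes> r"
      by (auto simp: I_def set_add_def' principal_def)
    have c: "p \<in> carrier R" "r \<in> carrier R" using pr P(3) A(1) by auto
    \<comment> \<open>As \<open>d = j \<otimes> e\<close>, the difference satisfies
      \<open>j \<otimes> m = p \<in> P\<close>. Primality and \<open>j \<notin> P\<close> give
      \<open>m \<in> P\<close>.\<close>
    define m where "m = n \<ominus> e \<otimes> r"
    have mA: "m \<in> A" unfolding m_def
      using submodule_diff[OF A1 subring_submodule[OF A1] nc(2) A(6)[OF ec(2) pr(2)]] .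
    have "j \<otimes> m = j \<otimes> n \<ominus> d \<otimes> r"
      unfolding m_def minus_eq e(2) using jc nc ec c by (simp add: r_distr r_minus m_assoc)
    also have "\<dots> = p" unfolding pr(3) minus_eq using c d by (simp add: a_assoc r_neg)
    finally have "m \<in> P" using P(8)[OF jc(2) mA] pr(1) jP by auto
    moreover have "n = m \<oplus> e \<otimes> r"
      unfolding m_def minus_eq using nc ec c by (simp add: a_assoc l_neg)
    moreover have "e \<otimes> r \<in> principal A e" using pr(2) by (auto simp: principal_def)
    ultimately show "n \<in> P <+>\<^bsub>R\<^esub> principal A e" using set_addI by blast
  qed
  define T where "T = P <+>\<^bsub>R\<^esub> principal A (e \<otimes> e)"
  have T: "submodule_of A T" unfolding T_def
    by (rule submodule_set_add[OF A(1) Ps submodule_principal[OF A1]]) (use ec in auto)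
  have "M \<cdot> M \<subseteq> T"
  proof (rule ideal_prod_le)
    fix n m assume "n \<in> M" "m \<in> M"
    then obtain p r q s where n: "p \<in> P" "r \<in> A" "n = p \<oplus> e \<otimes> r" and m: "q \<in> P" "s \<in> A" "m = q \<oplus> e \<otimes> s"
      using M_sub by (auto simp: set_add_def' principal_def subset_iff) metis
    have c: "p \<in> carrier R" "r \<in> carrier R" "q \<in> carrier R" "s \<in> carrier R"
      using n m P(3) A(1) by auto
    \<comment> \<open>Grouped so that each term of the first bracket carries a factor from
      \<open>P\<close>.\<close>
    have "n \<otimes> m = (m \<otimes> p \<oplus> (e \<otimes> r) \<otimes> q) \<oplus> e \<otimes> e \<otimes> (r \<otimes> s)"
      unfolding n(3) m(3) using c ec by (simp add: ring_ac)
    moreover have "m \<otimes> p \<in> P" using P(7)[OF _ n(1)] \<open>m \<in> M\<close> M(4) by auto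
    moreover have "(e \<otimes> r) \<otimes> q \<in> P" using P(7)[OF A(6)[OF ec(2) n(2)] m(1)] .
    moreover have "e \<otimes> e \<otimes> (r \<otimes> s) \<in> principal A (e \<otimes> e)" using A(6)[OF n(2) m(2)] by (auto simp: principal_def)
    ultimately show "n \<otimes> m \<in> T" unfolding T_def using set_addI P(6) by auto
  qed (rule submodule_add[OF T])
  hence "e \<in> T" using idem e(1) by auto
  then obtain p s where ps: "p \<in> P" "s \<in> A" "e = p \<oplus> e \<otimes> e \<otimes> s"
    by (auto simp: T_def set_add_def' principal_def)
  have c: "p \<in> carrier R" "s \<in> carrier R" using ps P(3) A(1) by auto
  have "e \<otimes> s \<in> M" by (rule submodule_rmult[OF M(3) A(1) ps(2) e(1)])
  note u = local_one_minus[OF A1 assms(2) this]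
  have "e \<otimes> (\<one> \<ominus> e \<otimes> s) = e \<ominus> e \<otimes> e \<otimes> s"
    unfolding minus_eq using ec c by (simp add: r_distr r_minus m_assoc)
  also have "\<dots> = (p \<oplus> e \<otimes> e \<otimes> s) \<ominus> e \<otimes> e \<otimes> s" using ps(3) by simp
  also have "\<dots> = p" unfolding minus_eq using ec c by (simp add: a_assoc r_neg)
  finally have "e \<otimes> (\<one> \<ominus> e \<otimes> s) \<in> P" using ps(1) by simp
  hence "e \<in> P" using P(8)[OF ec(2) u(1)] u(2) PM by auto
  thus False using P(7)[OF jc(2)] e(2) assms(5) by auto
qed

lemma field_lcancel:
  assumes "x \<in> carrier R" "x \<noteq> \<zero>" "y \<in> carrier R" "z \<in> carrier R" "x \<otimes> y = x \<otimes> z"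
  shows "y = z"
  using m_lcancel assms by blast

text \<open>A factor of an invertible module is invertible: \<open>H\<close> times the module
  generated by \<open>inv y\<close> is an inverse of \<open>Q\<close>. Over a local ring
  \<open>Q\<close> is then principal.\<close>

lemma principal_factor_of_principal:
  assumes "subring A R" "local_of A M" "y \<in> carrier R" "y \<noteq> \<zero>"
    and "submodule_of A Q" "submodule_of A H" "principal A y = Q \<cdot> H"
  obtains q where "q \<in> Q" "Q = principal A q"
proof -
  note A = subringE[OF assms(1)] and i = field_inverse[OF assms(3,4)]
  note S = submodule_principal[OF assms(1) i(1)]
  note c = submodule_carrier[OF assms(5)] submodule_carrier[OF assms(6)] submodule_carrier[OF S]
  have "Q \<cdot> (H \<cdot> principal A (inv y)) = principal A y \<cdot> principal A (inv y)"
    using ideal_prod_assoc[OF c] assms(7) by simp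
  also have "\<dots> = A" using principal_prod[OF assms(1,3) i(1)] i(2) principal_one[OF assms(1)] by simp
  finally show ?thesis
    using invertible_local_principal[OF assms(1,2) c(1) assms(5) submodule_ideal_prod[OF A(1) assms(6) S]]
      that by blast
qed

text \<open>
  A principal radical ideal \<open>(q)\<close> strictly below \<open>M\<close> is impossible: with \<open>P\<close> prime containing
  \<open>q\<close> but not \<open>d \<in> M\<close>, and \<open>N\<close> minimal over \<open>P + (d)\<close>, localizing at \<open>N\<close> gives a principal
  maximal ideal \<open>(c)\<close> with \<open>q = c\<^sup>2 w\<close>, so that \<open>c w\<close> would lie in \<open>(q)\<close>.
\<close>

lemma local_isp_principal:
  assumes "isp A" "local_of A M" "y \<in> M" "y \<noteq> \<zero>"
  obtains c where "c \<in> M" "M = principal A c"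
proof -
  note A1 = ispD(1)[OF assms(1)]
  note A = subringE[OF A1] and M = localD[OF assms(2)]
  have y: "y \<in> A" "y \<in> carrier R" using assms(3) M A by auto
  have yI: "y \<in> principal A y" by (rule principal_self[OF A1 y(2)])
  have "principal A y \<subseteq> M" by (rule principal_subset[OF M(3) A(1) assms(3)])
  hence "\<one> \<notin> principal A y" using M(5) by auto
  from isp_factor[OF assms(1) ideal_principal[OF A1 y(1)] this yI assms(4)]
  obtain J Qs where JQ: "invertible_of A J" "Qs \<noteq> []"
    "\<And>Q. Q \<in> set Qs \<Longrightarrow> semiprime_of A Q" "\<And>Q. Q \<in> set Qs \<Longrightarrow> \<one> \<notin> Q"
    and eq: "principal A y = J \<cdot> ideal_prods A Qs" by metis
  have J: "ideal_of A J" using JQ(1) by (simp add: invertible_of_def)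
  have Qi: "ideal_of A Q" if "Q \<in> set Qs" for Q using JQ(3)[OF that] by (simp add: semiprime_of_def)
  \<comment> \<open>Any radical factor will do: it divides the principal ideal generated by
    \<open>y\<close>, so it is principal, and it turns out to be \<open>M\<close>.\<close>
  obtain Q Rs where QR: "Qs = Q # Rs" using JQ(2) by (cases Qs) auto
  have Q: "semiprime_of A Q" "\<one> \<notin> Q" "ideal_of A Q" using JQ(3,4) Qi QR by auto
  have P: "ideal_of A (ideal_prods A Rs)"
    by (rule ideal_of_ideal_prods[OF A1]) (use Qi QR in auto)
  note ss = ideal_submodule[OF J] ideal_submodule[OF Q(3)] ideal_submodule[OF P]
  note cc = ss[THEN submodule_carrier]
  have "principal A y = Q \<cdot> (J \<cdot> ideal_prods A Rs)"
    using eq QR ideal_prod_assoc[OF cc] ideal_prod_assoc[OF cc(2,1,3)] ideal_prod_comm[OF cc(1,2)] by simp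
  from principal_factor_of_principal[OF A1 assms(2) y(2) assms(4) ss(2) submodule_ideal_prod[OF A(1) ss(1,3)] this]
  obtain q where q: "q \<in> Q" "Q = principal A q" by metis
  have QM: "Q \<subseteq> M" by (rule local_ideal_subset[OF assms(2) Q(3,2)])
  have qc: "q \<in> carrier R" "q \<in> A" using q(1) cc(2) ideal_subset[OF Q(3)] by auto
  have "y \<in> Q" using factor_subset[OF A1 J Qi, of Qs Q] yI eq QR by auto
  hence q0: "q \<noteq> \<zero>" using q(2) assms(4) A(1) by (auto simp: principal_def)
  have "M \<subseteq> Q"
  proof
    fix d assume d: "d \<in> M"
    have dA: "d \<in> A" using d M(4) by auto
    show "d \<in> Q"
    proof (rule ccontr)
      assume "d \<notin> Q"
      from prime_avoiding[OF A1 Q(1) dA this]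
      obtain P where P: "prime_of A P" "Q \<subseteq> P" "d \<notin> P" by metis
      have "insert d P \<subseteq> M"
        using d local_ideal_subset[OF assms(2) primeD(1)[OF P(1)] primeD(5)[OF P(1)]] by auto
      from minimal_prime[OF M(1) this]
      obtain N where N: "prime_of A N" "insert d P \<subseteq> N"
        and min: "\<And>P'. prime_of A P' \<Longrightarrow> insert d P \<subseteq> P' \<Longrightarrow> P' \<subseteq> N \<Longrightarrow> P' = N" by metis
      define B N' P' where "B = localize A N A" and "N' = localize A N N" and "P' = localize A N P"
      have NA: "insert d P \<subseteq> A" using N(2) primeD(2)[OF N(1)] by auto
      have PN: "P \<subseteq> N" using N(2) by auto
      have B: "isp B" unfolding B_def
        by (rule isp_flat_overring[OF assms(1) flat_localize[OF A1 N(1)]])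
      note B1 = ispD(1)[OF B]
      note BE = subringE[OF B1]
      have AB: "A \<subseteq> B" unfolding B_def by (rule localize_superset[OF A1 N(1) subset_refl])
      have loc: "local_of B N'" unfolding B_def N'_def by (rule local_localize[OF A1 N(1)])
      note N' = localD[OF loc]
      have P': "prime_of B P'" unfolding B_def P'_def by (rule prime_localize[OF A1 N(1) P(1) PN])
      have PP': "P \<subseteq> P'" unfolding P'_def
        by (rule localize_superset[OF A1 N(1) primeD(2)[OF P(1)]])
      have NN': "N \<subseteq> N'" unfolding N'_def
        by (rule localize_superset[OF A1 N(1) primeD(2)[OF N(1)]])
      have dP': "d \<notin> P'"
        using localize_prime_contract[OF A1 P(1) PN] P(3) dA unfolding P'_def by auto
      have dN': "d \<in> N'" using N(2) NN' by auto
      \<comment> \<open>Minimality of \<open>N\<close> over \<open>P\<close> and \<open>d\<close>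
        supplies the hypothesis under which idempotence was excluded.\<close>
      have rad: "H = N'" if H: "semiprime_of B H" "\<one> \<notin> H" "insert d P' \<subseteq> H" for H
        unfolding N'_def
        by (rule semiprime_localize_minimal[OF A1 N(1) NA min])
          (use H PP' in \<open>auto simp: B_def\<close>)
      have "\<not> N' \<subseteq> N' \<cdot> N'"
        by (rule local_isp_not_idempotent[OF B loc P' dN' dP' rad])
      then obtain c where c: "c \<in> N'" "c \<notin> N' \<cdot> N'" by auto
      have N'c: "N' = principal B c" by (rule local_isp_generator[OF B loc c])
      have cc: "c \<in> B" "c \<in> carrier R" using c(1) N'(4) BE(1) by auto
      have cP': "c \<notin> P'"
      proof
        assume "c \<in> P'"
        hence "N' \<subseteq> P'"
          unfolding N'c by (rule principal_subset[OF ideal_submodule[OF primeD(1)[OF P']] BE(1)])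
        thus False using dN' dP' by auto
      qed
      have qP': "q \<in> P'" using q(1) P(2) PP' by auto
      hence "q \<in> N'" using local_ideal_subset[OF loc primeD(1)[OF P'] primeD(5)[OF P']] by auto
      then obtain r where r: "r \<in> B" "q = c \<otimes> r" unfolding N'c by (auto simp: principal_def)
      \<comment> \<open>The prime \<open>P'\<close> contains \<open>q = c \<otimes> r\<close> but
        not \<open>c\<close>, so \<open>r\<close> lies in the maximal ideal too and a second factor
        \<open>c\<close> splits off.\<close>
      have "r \<in> P'" using primeD(8)[OF P' cc(1) r(1)] qP' r(2) cP' by auto
      hence "r \<in> N'" using local_ideal_subset[OF loc primeD(1)[OF P'] primeD(5)[OF P']] by auto
      then obtain w where w: "w \<in> B" "r = c \<otimes> w" unfolding N'c by (auto simp: principal_def)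
      have wc: "w \<in> carrier R" using w BE(1) by auto
      have QB: "semiprime_of B (Q \<cdot> B)"
        unfolding B_def by (rule semiprime_extend[OF A1 flat_localize[OF A1 N(1)] Q(1)])
      \<comment> \<open>Since \<open>q = c \<otimes> (c \<otimes> w)\<close>, the extended radical
        ideal contains this square and so \<open>c \<otimes> w\<close> itself. Being a multiple of
        \<open>q\<close>, that element can be cancelled, which makes \<open>c\<close> a
        unit.\<close>
      have "(c \<otimes> w) \<otimes> (c \<otimes> w) = q \<otimes> w"
        unfolding r(2) w(2) using cc wc by (simp add: m_assoc m_comm m_lcomm)
      also have "\<dots> \<in> Q \<cdot> B" using q(1) w(1) by (rule ideal_prod.prod)
      finally have "c \<otimes> w \<in> Q \<cdot> B" using QB BE(6)[OF cc(1) w(1)] by (auto simp: semiprime_of_def)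
      moreover have "Q \<subseteq> principal B q" unfolding q(2) using AB by (auto simp: principal_def)
      hence "Q \<cdot> B \<subseteq> principal B q" by (rule extend_subset[OF B1 submodule_principal[OF B1 qc(1)]])
      ultimately obtain s where s: "s \<in> B" "c \<otimes> w = q \<otimes> s" by (auto simp: principal_def)
      have sc: "s \<in> carrier R" using s BE(1) by auto
      have cw0: "c \<otimes> w \<noteq> \<zero>" using q0 r(2) w(2) cc by auto
      have "c \<otimes> w = c \<otimes> (c \<otimes> w) \<otimes> s" using s(2) unfolding r(2) w(2) .
      moreover have "c \<otimes> (c \<otimes> w) \<otimes> s = (c \<otimes> w) \<otimes> (c \<otimes> s)"
        using cc(2) wc sc by (simp add: m_assoc m_comm m_lcomm)
      ultimately have eqw: "(c \<otimes> w) \<otimes> \<one> = (c \<otimes> w) \<otimes> (c \<otimes> s)" using cc(2) wc by simp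
      have "\<one> = c \<otimes> s" by (rule field_lcancel[OF _ cw0 _ _ eqw]) (use cc wc sc in auto)
      hence "\<one> \<in> N'" unfolding N'c using s(1) by (auto simp: principal_def)
      thus False using N'(5) by simp
    qed
  qed
  hence "M = Q" using QM by auto
  thus ?thesis using that q by auto
qed

section \<open>ISP-domains are Pruefer domains\<close>

text \<open>
  With \<open>D = A : t\<close>, the ideal \<open>D + D t\<close> is the product of the fractional ideal \<open>(1, t)\<close> with its
  inverse, so \<open>A\<close> is a Pruefer domain iff this ideal is \<open>A\<close> for every \<open>t\<close>.
\<close>

definition pruefer_ideal :: "'a set \<Rightarrow> 'a \<Rightarrow> 'a set" where
  "pruefer_ideal A t = {d \<oplus> e \<otimes> t | d e. d \<in> colon A A t \<and> e \<in> colon A A t}"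

lemma ideal_pruefer_ideal:
  assumes "subring A R" "t \<in> carrier R"
  shows "ideal_of A (pruefer_ideal A t)"
  unfolding ideal_of_def submodule_of_def
proof (intro conjI ballI)
  note A = subringE[OF assms(1)]
  note D = ideal_submodule[OF ideal_colon[OF assms(1) subring_submodule[OF assms(1)] assms(2)]]
  have Dc: "d \<in> carrier R" "d \<in> A" "d \<otimes> t \<in> A" if "d \<in> colon A A t" for d
    using that A(1) by (auto simp: colon_def)
  show sub: "pruefer_ideal A t \<subseteq> A" using Dc A(7) by (auto simp: pruefer_ideal_def)
  thus "pruefer_ideal A t \<subseteq> carrier R" using A(1) by auto
  have I: "d \<oplus> e \<otimes> t \<in> pruefer_ideal A t" if "d \<in> colon A A t" "e \<in> colon A A t" for d e
    using that by (auto simp: pruefer_ideal_def)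
  show "\<zero> \<in> pruefer_ideal A t"
    using I[OF submodule_zero[OF D] submodule_zero[OF D]] assms(2) by simp
  fix x assume "x \<in> pruefer_ideal A t"
  then obtain d e where x: "d \<in> colon A A t" "e \<in> colon A A t" "x = d \<oplus> e \<otimes> t"
    by (auto simp: pruefer_ideal_def)
  note xc = Dc[OF x(1)] Dc[OF x(2)]
  { fix y assume "y \<in> pruefer_ideal A t"
    then obtain d' e' where y: "d' \<in> colon A A t" "e' \<in> colon A A t" "y = d' \<oplus> e' \<otimes> t"
      by (auto simp: pruefer_ideal_def)
    note yc = Dc[OF y(1)] Dc[OF y(2)]
    have "x \<oplus> y = (d \<oplus> d') \<oplus> (e \<oplus> e') \<otimes> t"
      unfolding x(3) y(3) using xc yc assms(2) by (simp add: l_distr a_ac)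
    thus "x \<oplus> y \<in> pruefer_ideal A t"
      using I[OF submodule_add[OF D x(1) y(1)] submodule_add[OF D x(2) y(2)]] by simp }
  fix a assume a: "a \<in> A"
  have ac: "a \<in> carrier R" using a A(1) by auto
  have "a \<otimes> x = a \<otimes> d \<oplus> (a \<otimes> e) \<otimes> t"
    unfolding x(3) using xc ac assms(2) by (simp add: r_distr m_assoc)
  thus "a \<otimes> x \<in> pruefer_ideal A t"
    using I[OF submodule_lmult[OF D a x(1)] submodule_lmult[OF D a x(2)]] by simp
qed

lemma colon_in_pruefer_ideal:
  assumes "subring A R" "t \<in> carrier R" "d \<in> colon A A t"
  shows "d \<in> pruefer_ideal A t" "d \<otimes> t \<in> pruefer_ideal A t"
proof -
  note A = subringE[OF assms(1)]
  note D = ideal_submodule[OF ideal_colon[OF assms(1) subring_submodule[OF assms(1)] assms(2)]]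
  have c: "d \<in> carrier R" using assms(3) A(1) by (auto simp: colon_def)
  have I: "d \<oplus> e \<otimes> t \<in> pruefer_ideal A t" if "d \<in> colon A A t" "e \<in> colon A A t" for d e
    using that by (auto simp: pruefer_ideal_def)
  show "d \<in> pruefer_ideal A t" using I[OF assms(3) submodule_zero[OF D]] c assms(2) by simp
  show "d \<otimes> t \<in> pruefer_ideal A t" using I[OF submodule_zero[OF D] assms(3)] c assms(2) by simp
qed

text \<open>For \<open>d\<close> in the colon ideal both \<open>d = y \<otimes> r\<close> and
  \<open>d \<otimes> t = y \<otimes> s\<close> are multiples of \<open>y\<close>. Hence
  \<open>r \<otimes> t = s \<in> A\<close>, so the quotient \<open>r\<close> is again in the colon
  ideal. Dividing a representation of \<open>y\<close> by \<open>y\<close> then represents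
  \<open>\<one>\<close>.\<close>

lemma one_in_pruefer_ideal_if_principal:
  assumes "subring A R" "t \<in> carrier R" "pruefer_ideal A t = principal A y" "y \<in> carrier R" "y \<noteq> \<zero>"
  shows "\<one> \<in> pruefer_ideal A t"
proof -
  note A = subringE[OF assms(1)]
  have quot: "\<exists>r\<in>colon A A t. d = y \<otimes> r" if d: "d \<in> colon A A t" for d
  proof -
    obtain r where r: "r \<in> A" "d = y \<otimes> r"
      using colon_in_pruefer_ideal(1)[OF assms(1,2) d] assms(3) by (auto simp: principal_def)
    obtain s where s: "s \<in> A" "d \<otimes> t = y \<otimes> s"
      using colon_in_pruefer_ideal(2)[OF assms(1,2) d] assms(3) by (auto simp: principal_def)
    have c: "r \<in> carrier R" "s \<in> carrier R" using r s A(1) by auto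
    have "y \<otimes> (r \<otimes> t) = d \<otimes> t" unfolding r(2) using c assms(2,4) by (simp add: m_assoc)
    hence eq: "y \<otimes> (r \<otimes> t) = y \<otimes> s" using s(2) by simp
    have "r \<otimes> t = s" by (rule field_lcancel[OF assms(4,5) _ _ eq]) (use c assms(2) in auto)
    hence "r \<in> colon A A t" using r(1) s(1) by (simp add: colon_def)
    thus ?thesis using r(2) by blast
  qed
  have "y \<in> pruefer_ideal A t" using principal_self[OF assms(1,4)] assms(3) by simp
  then obtain d e where de: "d \<in> colon A A t" "e \<in> colon A A t" "y = d \<oplus> e \<otimes> t"
    unfolding pruefer_ideal_def by blast
  obtain r r' where r: "r \<in> colon A A t" "d = y \<otimes> r" "r' \<in> colon A A t" "e = y \<otimes> r'"
    using quot[OF de(1)] quot[OF de(2)] by blast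
  have c: "r \<in> carrier R" "r' \<in> carrier R" using r A(1) by (auto simp: colon_def)
  have "y \<otimes> (r \<oplus> r' \<otimes> t) = y \<otimes> r \<oplus> y \<otimes> r' \<otimes> t"
    using c assms(2,4) by (simp add: r_distr m_assoc)
  also have "\<dots> = y" using de(3) unfolding r(2,4) by (rule sym)
  also have "\<dots> = y \<otimes> \<one>" using assms(4) by simp
  finally have eq: "y \<otimes> \<one> = y \<otimes> (r \<oplus> r' \<otimes> t)" by (rule sym)
  have "\<one> = r \<oplus> r' \<otimes> t" by (rule field_lcancel[OF assms(4,5) _ _ eq]) (use c assms(2) in auto)
  thus ?thesis using r(1,3) by (auto simp: pruefer_ideal_def)
qed

lemma local_isp_pruefer:
  assumes "isp A" "local_of A M" "t \<in> carrier R"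
    and rad: "\<And>Q. semiprime_of A Q \<Longrightarrow> \<one> \<notin> Q \<Longrightarrow> pruefer_ideal A t \<subseteq> Q \<Longrightarrow> Q = M"
  shows "\<one> \<in> pruefer_ideal A t"
proof (rule ccontr)
  assume n: "\<one> \<notin> pruefer_ideal A t"
  note A1 = ispD(1)[OF assms(1)]
  note A = subringE[OF A1] and M = localD[OF assms(2)]
  note F = ideal_pruefer_ideal[OF A1 assms(3)]
  \<comment> \<open>A nonzero denominator of \<open>t\<close> shows that the ideal is nonzero, hence
    that \<open>M\<close> is nonzero and thus principal.\<close>
  obtain b where b: "b \<in> A" "b \<noteq> \<zero>" "b \<otimes> t \<in> A" using ispD(2)[OF assms(1,3)] by auto
  hence bF: "b \<in> pruefer_ideal A t"
    using colon_in_pruefer_ideal(1)[OF A1 assms(3)] by (auto simp: colon_def)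
  hence "b \<in> M" using local_ideal_subset[OF assms(2) F n] by auto
  from local_isp_principal[OF assms(1,2) this b(2)]
  obtain c where c: "c \<in> M" "M = principal A c" by metis
  have cc: "c \<in> carrier R" using c M(4) A(1) by auto
  from isp_factor[OF assms(1) F n bF b(2)]
  obtain J Qs where JQ: "invertible_of A J" "Qs \<noteq> []"
    "\<And>Q. Q \<in> set Qs \<Longrightarrow> semiprime_of A Q" "\<And>Q. Q \<in> set Qs \<Longrightarrow> \<one> \<notin> Q"
    and eq: "pruefer_ideal A t = J \<cdot> ideal_prods A Qs" by metis
  have J: "ideal_of A J" using JQ(1) by (simp add: invertible_of_def)
  note Js = ideal_submodule[OF J]
  have Qi: "ideal_of A Q" if "Q \<in> set Qs" for Q using JQ(3)[OF that] by (simp add: semiprime_of_def)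
  have QM: "Q = M" if Q: "Q \<in> set Qs" for Q
    using rad[OF JQ(3)[OF Q] JQ(4)[OF Q]] factor_subset[OF A1 J Qi Q] eq by auto
  have "\<exists>g\<in>carrier R. ideal_prods A Rs = principal A g" if "\<And>Q. Q \<in> set Rs \<Longrightarrow> Q = M" for Rs
    using that
  proof (induct Rs)
    case Nil
    show ?case using principal_one[OF A1] by (auto intro: bexI[of _ \<one>])
  next
    case (Cons Q Rs)
    have "\<exists>g\<in>carrier R. ideal_prods A Rs = principal A g" using Cons by simp
    then obtain g where g: "g \<in> carrier R" "ideal_prods A Rs = principal A g" by auto
    have "Q = principal A c" using Cons(2)[of Q] c(2) by simp
    hence "ideal_prods A (Q # Rs) = principal A (c \<otimes> g)" using g principal_prod[OF A1 cc g(1)] by simp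
    thus ?case using cc g(1) by blast
  qed
  from this[OF QM] obtain g where g: "g \<in> carrier R" "ideal_prods A Qs = principal A g" by auto
  obtain L where L: "submodule_of A L" "J \<cdot> L = A" using JQ(1) by (auto simp: invertible_of_def)
  obtain j where j: "j \<in> J" "J = principal A j"
    by (rule invertible_local_principal[OF A1 assms(2) submodule_carrier[OF Js] Js L])
  have jc: "j \<in> carrier R" using j(1) submodule_carrier[OF Js] by auto
  have yF: "pruefer_ideal A t = principal A (j \<otimes> g)"
    using eq g j(2) principal_prod[OF A1 jc g(1)] by simp
  have "j \<otimes> g \<noteq> \<zero>" using bF b(2) A(1) unfolding yF by (auto simp: principal_def)
  from one_in_pruefer_ideal_if_principal[OF A1 assms(3) yF _ this] n jc g(1) show False by simp
qed

text \<open>One denominator brings \<open>x\<close> into \<open>A\<close>, another brings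
  \<open>x \<otimes> t\<close> there, and their product does both. This carries a relation over the
  localization back to \<open>A\<close>.\<close>

lemma colon_localize:
  assumes "subring A R" "prime_of A N" "t \<in> carrier R" "x \<in> colon (localize A N A) (localize A N A) t"
  shows "\<exists>s\<in>A - N. s \<otimes> x \<in> colon A A t"
proof -
  note A = subringE[OF assms(1)]
  obtain s u where s: "s \<in> A - N" "s \<otimes> x \<in> A" and u: "u \<in> A - N" "u \<otimes> (x \<otimes> t) \<in> A"
    and x: "x \<in> carrier R"
    using assms(4) by (auto simp: colon_def localize_def)
  have c: "s \<in> carrier R" "u \<in> carrier R" using s u A(1) by auto
  have "u \<otimes> s \<otimes> x = u \<otimes> (s \<otimes> x)" "u \<otimes> s \<otimes> x \<otimes> t = s \<otimes> (u \<otimes> (x \<otimes> t))"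
    using c x assms(3) by (simp_all add: m_assoc m_lcomm)
  hence "u \<otimes> s \<otimes> x \<in> colon A A t" using s u A(6) by (simp add: colon_def)
  thus ?thesis using prime_complement_mult[OF assms(1,2) u(1) s(1)] by auto
qed

lemma isp_pruefer:
  assumes "isp A" "t \<in> carrier R"
  shows "\<one> \<in> pruefer_ideal A t"
proof (rule ccontr)
  assume n: "\<one> \<notin> pruefer_ideal A t"
  note A1 = ispD(1)[OF assms(1)]
  note A = subringE[OF A1] and F = ideal_pruefer_ideal[OF A1 assms(2)]
  obtain b where b: "b \<in> A" "b \<noteq> \<zero>" "b \<otimes> t \<in> A" using ispD(2)[OF assms] by auto
  hence bF: "b \<in> pruefer_ideal A t"
    using colon_in_pruefer_ideal(1)[OF A1 assms(2)] by (auto simp: colon_def)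
  from isp_factor[OF assms(1) F n bF b(2)]
  obtain J Qs where JQ: "invertible_of A J" "Qs \<noteq> []"
    "\<And>Q. Q \<in> set Qs \<Longrightarrow> semiprime_of A Q" "\<And>Q. Q \<in> set Qs \<Longrightarrow> \<one> \<notin> Q"
    and eq: "pruefer_ideal A t = J \<cdot> ideal_prods A Qs" by metis
  have J: "ideal_of A J" using JQ(1) by (simp add: invertible_of_def)
  have Qi: "ideal_of A Q" if "Q \<in> set Qs" for Q using JQ(3)[OF that] by (simp add: semiprime_of_def)
  obtain Q where Q: "Q \<in> set Qs" using JQ(2) by (cases Qs) auto
  have FQ: "pruefer_ideal A t \<subseteq> Q" using factor_subset[OF A1 J Qi Q] eq by simp
  \<comment> \<open>Avoiding \<open>\<one>\<close> just produces some prime above the ideal, from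
    which a minimal one is reached.\<close>
  from prime_avoiding[OF A1 JQ(3)[OF Q] A(3) JQ(4)[OF Q]]
  obtain P where P: "prime_of A P" "Q \<subseteq> P" by metis
  from minimal_prime[OF P(1) subset_trans[OF FQ P(2)]]
  obtain N where N: "prime_of A N" "pruefer_ideal A t \<subseteq> N"
    and min: "\<And>P. prime_of A P \<Longrightarrow> pruefer_ideal A t \<subseteq> P \<Longrightarrow> P \<subseteq> N \<Longrightarrow> P = N" by metis
  define B where "B = localize A N A"
  have B: "isp B" unfolding B_def
    by (rule isp_flat_overring[OF assms(1) flat_localize[OF A1 N(1)]])
  note B1 = ispD(1)[OF B]
  have AB: "A \<subseteq> B" unfolding B_def by (rule localize_superset[OF A1 N(1) subset_refl])
  have loc: "local_of B (localize A N N)" unfolding B_def by (rule local_localize[OF A1 N(1)])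
  \<comment> \<open>Minimality of \<open>N\<close> speaks of the ideal over \<open>A\<close>, while
    the local lemma speaks of the one over \<open>B\<close>; this inclusion connects them.\<close>
  have "colon A A t \<subseteq> colon B B t" using AB by (auto simp: colon_def)
  hence FF: "pruefer_ideal A t \<subseteq> pruefer_ideal B t" unfolding pruefer_ideal_def by blast
  have "\<one> \<in> pruefer_ideal B t"
  proof (rule local_isp_pruefer[OF B loc assms(2)])
    fix H assume H: "semiprime_of B H" "\<one> \<notin> H" "pruefer_ideal B t \<subseteq> H"
    show "H = localize A N N"
      by (rule semiprime_localize_minimal[OF A1 N(1) ideal_subset[OF F] min])
        (use H FF in \<open>auto simp: B_def\<close>)
  qed
  then obtain x y where xy: "x \<in> colon B B t" "y \<in> colon B B t" "\<one> = x \<oplus> y \<otimes> t"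
    unfolding pruefer_ideal_def by blast
  obtain s u where s: "s \<in> A - N" "s \<otimes> x \<in> colon A A t" and u: "u \<in> A - N" "u \<otimes> y \<in> colon A A t"
    using colon_localize[OF A1 N(1) assms(2) xy(1)[unfolded B_def]]
      colon_localize[OF A1 N(1) assms(2) xy(2)[unfolded B_def]] by blast
  note D = ideal_submodule[OF ideal_colon[OF A1 subring_submodule[OF A1] assms(2)]]
  have c: "s \<in> carrier R" "u \<in> carrier R" "x \<in> carrier R" "y \<in> carrier R"
    using s(1) u(1) A(1) xy(1,2) subringE(1)[OF B1] by (auto simp: colon_def)
  \<comment> \<open>Clearing denominators in the relation for \<open>\<one>\<close> puts
    \<open>s \<otimes> u\<close>, an element outside \<open>N\<close>, into the ideal over
    \<open>A\<close>, which lies in \<open>N\<close>.\<close>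
  have "s \<otimes> u = s \<otimes> u \<otimes> (x \<oplus> y \<otimes> t)" unfolding xy(3)[symmetric] using c by simp
  also have "\<dots> = u \<otimes> (s \<otimes> x) \<oplus> s \<otimes> (u \<otimes> y) \<otimes> t"
    using c assms(2) by (simp add: r_distr m_assoc m_lcomm)
  also have "\<dots> \<in> pruefer_ideal A t"
    using submodule_lmult[OF D _ s(2)] submodule_lmult[OF D _ u(2)] s(1) u(1)
    unfolding pruefer_ideal_def by blast
  finally show False using N(2) prime_complement_mult[OF A1 N(1) s(1) u(1)] by auto
qed

text \<open>As \<open>\<one>\<close> and \<open>x\<close> both lie in \<open>B\<close>, a relation
  \<open>\<one> = d \<oplus> e \<otimes> x\<close> with \<open>d\<close> and \<open>e\<close> in
  \<open>A : x\<close> is already a membership in \<open>(A : x) \<cdot> B\<close>.\<close>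

lemma isp_flat:
  assumes "isp A" "subring B R" "A \<subseteq> B"
  shows "flat_overring A B"
  unfolding flat_overring_def
proof (intro conjI ballI assms(2,3))
  fix x assume x: "x \<in> B"
  hence xc: "x \<in> carrier R" using subringE(1)[OF assms(2)] by auto
  obtain d e where de: "d \<in> colon A A x" "e \<in> colon A A x" "\<one> = d \<oplus> e \<otimes> x"
    using isp_pruefer[OF assms(1) xc] by (auto simp: pruefer_ideal_def)
  have "d \<in> carrier R" using de(1) subringE(1)[OF ispD(1)[OF assms(1)]] by (auto simp: colon_def)
  hence "d \<otimes> \<one> = d" by simp
  hence "\<one> = d \<otimes> \<one> \<oplus> e \<otimes> x" using de(3) by argo
  also have "\<dots> \<in> colon A A x \<cdot> B"
    by (intro ideal_prod.intros de x subringE(3)[OF assms(2)])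
  finally show "\<one> \<in> colon A A x \<cdot> B" .
qed

section \<open>Comparison with the ring-theoretic definitions\<close>

lemma ideal_iff_ideal_of:
  assumes "subring A R"
  shows "ideal I (R\<lparr>carrier := A\<rparr>) \<longleftrightarrow> ideal_of A I"
proof
  note A = subringE[OF assms]
  assume "ideal I (R\<lparr>carrier := A\<rparr>)"
  then interpret I: ideal I "R\<lparr>carrier := A\<rparr>" .
  show "ideal_of A I"
    unfolding ideal_of_def submodule_of_def
    using I.a_subset additive_subgroup.zero_closed[OF I.is_additive_subgroup]
      additive_subgroup.a_closed[OF I.is_additive_subgroup] I.I_l_closed A(1) by auto
next
  note A = subringE[OF assms]
  assume I: "ideal_of A I"
  note Is = ideal_submodule[OF I]
  interpret RA: ring "R\<lparr>carrier := A\<rparr>" by (rule subring_is_ring[OF assms])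
  show "ideal I (R\<lparr>carrier := A\<rparr>)"
  proof (rule idealI[OF subring_is_ring[OF assms]])
    show "subgroup I (add_monoid (R\<lparr>carrier := A\<rparr>))"
    proof (rule RA.add.subgroupI)
      show "I \<subseteq> carrier (R\<lparr>carrier := A\<rparr>)" using ideal_subset[OF I] by simp
      show "I \<noteq> {}" using submodule_zero[OF Is] by auto
      show "\<ominus>\<^bsub>R\<lparr>carrier := A\<rparr>\<^esub> x \<in> I" if "x \<in> I" for x
      proof -
        \<comment> \<open>The negative in the restricted ring depends on its carrier; uniqueness of
          negatives identifies it with the one in the field.\<close>
        have "\<ominus> x \<oplus> x = \<zero>" using that submodule_carrier[OF Is] by (auto simp: l_neg)
        hence "\<ominus>\<^bsub>R\<lparr>carrier := A\<rparr>\<^esub> x = \<ominus> x"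
          using that ideal_subset[OF I] A(5) by (intro RA.minus_equality) auto
        thus ?thesis using submodule_minus[OF assms Is that] by simp
      qed
      show "x \<oplus>\<^bsub>R\<lparr>carrier := A\<rparr>\<^esub> y \<in> I" if "x \<in> I" "y \<in> I" for x y
        using submodule_add[OF Is that] by simp
    qed
  qed (use submodule_lmult[OF Is] submodule_rmult[OF Is A(1)] in auto)
qed

text \<open>Square roots suffice because the exponent can be halved repeatedly.\<close>

lemma semiprime_pow:
  assumes "subring A R" "semiprime_of A Q" "x \<in> A" "x [^] n \<in> Q" "(n::nat) > 0"
  shows "x \<in> Q"
  using assms(4,5)
proof (induct n rule: less_induct)
  case (less n)
  note A = subringE[OF assms(1)]
  have Q: "submodule_of A Q" using assms(2) by (simp add: semiprime_of_def ideal_of_def)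
  have xc: "x \<in> carrier R" using assms(3) A(1) by auto
  have pA: "x [^] k \<in> A" for k :: nat using A(3) A(6)[OF _ assms(3)] by (induct k) auto
  show ?case
  proof (cases "n = 1")
    case True
    thus ?thesis using less(2) xc by simp
  next
    case False
    \<comment> \<open>Rounding up makes \<open>m + m\<close> at least \<open>n\<close>, so the
      square of \<open>x [^] m\<close> is a multiple of \<open>x [^] n\<close>. The descent is
      strict only for \<open>n > 1\<close>, whence the separate case.\<close>
    define m where "m = (n + 1) div 2"
    have m: "m < n" "m > 0" "m + m = (m + m - n) + n" using False less(3) by (auto simp: m_def)
    have "x [^] m \<otimes> x [^] m = x [^] (m + m - n) \<otimes> x [^] n"
      using m(3) nat_pow_mult[OF xc] by metis
    also have "\<dots> \<in> Q" by (rule submodule_lmult[OF Q pA less(2)])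
    finally have "x [^] m \<in> Q" using assms(2) pA by (auto simp: semiprime_of_def)
    thus ?thesis using less(1) m by auto
  qed
qed

lemma radical_ideal_iff_semiprime_of:
  assumes "subring A R"
  shows "radical_ideal (R\<lparr>carrier := A\<rparr>) Q \<longleftrightarrow> semiprime_of A Q"
proof
  note A = subringE[OF assms]
  have pow: "x [^]\<^bsub>R\<lparr>carrier := A\<rparr>\<^esub> n = x [^] n" for x and n :: nat
    by (simp add: nat_pow_consistent[symmetric])
  { assume r: "radical_ideal (R\<lparr>carrier := A\<rparr>) Q"
    have "x \<in> Q" if x: "x \<in> A" "x \<otimes> x \<in> Q" for x
    proof -
      have "x [^] (2::nat) \<in> Q" using x A(1) by (auto simp: numeral_2_eq_2)
      hence "x \<in> radical (R\<lparr>carrier := A\<rparr>) Q"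
        unfolding radical_def using x(1) pow by (auto intro: exI[of _ "2::nat"])
      thus ?thesis using r by (simp add: radical_ideal_def)
    qed
    thus "semiprime_of A Q"
      using r ideal_iff_ideal_of[OF assms] by (auto simp: semiprime_of_def radical_ideal_def) }
  assume s: "semiprime_of A Q"
  have "radical (R\<lparr>carrier := A\<rparr>) Q \<subseteq> Q"
    unfolding radical_def using semiprime_pow[OF assms s] pow by auto
  moreover have "Q \<subseteq> radical (R\<lparr>carrier := A\<rparr>) Q"
  proof
    fix x assume x: "x \<in> Q"
    hence "x \<in> A" "x \<in> carrier R" using s A(1) by (auto simp: semiprime_of_def ideal_of_def)
    hence "x [^] (1::nat) \<in> Q" using x by simp
    thus "x \<in> radical (R\<lparr>carrier := A\<rparr>) Q"
      unfolding radical_def using \<open>x \<in> A\<close> pow by (auto intro: exI[of _ "1::nat"])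
  qed
  ultimately show "radical_ideal (R\<lparr>carrier := A\<rparr>) Q"
    using s ideal_iff_ideal_of[OF assms] by (auto simp: semiprime_of_def radical_ideal_def)
qed

text \<open>An inverse module has bounded denominators: any nonzero element of \<open>J\<close> is one.\<close>

lemma invertible_ideal_iff:
  assumes "subring A R"
  shows "invertible_ideal R A J \<longleftrightarrow> invertible_of A J"
proof
  note A = subringE[OF assms]
  assume "invertible_ideal R A J"
  then obtain L where L: "fractional_ideal R A L" "J \<cdot> L = A" and J: "ideal_of A J"
    using ideal_iff_ideal_of[OF assms] by (auto simp: invertible_ideal_def)
  interpret L: additive_subgroup L R using L(1) by (simp add: fractional_ideal_def)
  have "submodule_of A L"
    unfolding submodule_of_def using L(1) L.a_subset L.zero_closed L.a_closed
    by (auto simp: fractional_ideal_def)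
  thus "invertible_of A J" using L J by (auto simp: invertible_of_def)
next
  note A = subringE[OF assms]
  assume "invertible_of A J"
  then obtain L where L: "submodule_of A L" "J \<cdot> L = A" and J: "ideal_of A J"
    by (auto simp: invertible_of_def)
  have "subgroup L (add_monoid R)"
    by (rule add.subgroupI)
      (use submodule_carrier[OF L(1)] submodule_zero[OF L(1)] submodule_minus[OF assms L(1)]
        submodule_add[OF L(1)] in auto)
  hence "additive_subgroup L R" by (rule additive_subgroupI)
  moreover have "\<exists>d\<in>J. d \<noteq> \<zero>"
  proof (rule ccontr)
    assume "\<not> ?thesis"
    hence "J \<subseteq> {\<zero>}" by auto
    hence "J \<cdot> L \<subseteq> {\<zero>}" using submodule_carrier[OF L(1)] by (intro ideal_prod_le) (auto dest!: subsetD)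
    thus False using L(2) A(3) by auto
  qed
  moreover have "d \<otimes> x \<in> A" if "d \<in> J" "x \<in> L" for d x
    using ideal_prod.prod[OF that, of R] L(2) by simp
  ultimately have "\<exists>d\<in>A - {\<zero>}. \<forall>x\<in>L. d \<otimes> x \<in> A" using ideal_subset[OF J] by blast
  hence "fractional_ideal R A L"
    using \<open>additive_subgroup L R\<close> submodule_lmult[OF L(1)] by (simp add: fractional_ideal_def)
  thus "invertible_ideal R A J"
    using L(2) J ideal_iff_ideal_of[OF assms] by (auto simp: invertible_ideal_def)
qed

lemma is_quotient_field_iff:
  assumes "subring A R"
  shows "is_quotient_field R A \<longleftrightarrow> (\<forall>x\<in>carrier R. \<exists>b\<in>A. b \<noteq> \<zero> \<and> b \<otimes> x \<in> A)"
proof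
  note A = subringE[OF assms]
  assume q: "is_quotient_field R A"
  show "\<forall>x\<in>carrier R. \<exists>b\<in>A. b \<noteq> \<zero> \<and> b \<otimes> x \<in> A"
  proof
    fix x assume "x \<in> carrier R"
    then obtain a b where ab: "a \<in> A" "b \<in> A" "b \<noteq> \<zero>" "x = a \<otimes> inv b"
      using q by (auto simp: is_quotient_field_def)
    have c: "a \<in> carrier R" "b \<in> carrier R" using ab A(1) by auto
    note i = field_inverse[OF c(2) ab(3)]
    have "b \<otimes> x = a" using ab(4) c i by (simp add: m_lcomm)
    thus "\<exists>b\<in>A. b \<noteq> \<zero> \<and> b \<otimes> x \<in> A" using ab by auto
  qed
next
  note A = subringE[OF assms]
  assume q: "\<forall>x\<in>carrier R. \<exists>b\<in>A. b \<noteq> \<zero> \<and> b \<otimes> x \<in> A"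
  have "\<exists>a b. x = a \<otimes> inv b \<and> a \<in> A \<and> b \<in> A - {\<zero>}" if x: "x \<in> carrier R" for x
  proof -
    obtain b where b: "b \<in> A" "b \<noteq> \<zero>" "b \<otimes> x \<in> A" using q x by auto
    have c: "b \<in> carrier R" using b A(1) by auto
    note i = field_inverse[OF c b(2)]
    have "(b \<otimes> x) \<otimes> inv b = x \<otimes> (b \<otimes> inv b)" using x c i(1) by (simp add: m_assoc m_lcomm)
    hence "x = (b \<otimes> x) \<otimes> inv b" using x i(2) by simp
    thus ?thesis using b by blast
  qed
  moreover have "a \<otimes> inv b \<in> carrier R" if "a \<in> A" "b \<in> A - {\<zero>}" for a b
    using that A(1) field_inverse(1)[of b] by auto
  ultimately have "carrier R = {a \<otimes> inv b | a b. a \<in> A \<and> b \<in> A - {\<zero>}}" by blast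
  thus "is_quotient_field R A" using field_axioms assms by (simp add: is_quotient_field_def)
qed

lemma ideal_prod_subring [simp]: "ideal_prod (R\<lparr>carrier := A\<rparr>) I J = I \<cdot> J"
proof
  show "ideal_prod (R\<lparr>carrier := A\<rparr>) I J \<subseteq> I \<cdot> J"
  proof
    fix x assume "x \<in> ideal_prod (R\<lparr>carrier := A\<rparr>) I J"
    thus "x \<in> I \<cdot> J" by induct (auto intro: ideal_prod.intros)
  qed
  show "I \<cdot> J \<subseteq> ideal_prod (R\<lparr>carrier := A\<rparr>) I J"
    by (rule ideal_prod_le)
      (use ideal_prod.prod[of _ I _ J "R\<lparr>carrier := A\<rparr>"]
        ideal_prod.sum[of _ "R\<lparr>carrier := A\<rparr>" I J] in auto)
qed

lemma ISP_domain_iff_isp: "ISP_domain R A \<longleftrightarrow> isp A"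
proof (cases "subring A R")
  case False
  thus ?thesis by (simp add: ISP_domain_def isp_def is_quotient_field_def)
next
  case True
  \<comment> \<open>An equation between functions, because \<open>foldl\<close> takes the product
    unapplied.\<close>
  have prod: "ideal_prod (R\<lparr>carrier := A\<rparr>) = ideal_prod R" by (intro ext) simp
  have fac: "invertible_of A J \<and> length Qs \<ge> 1 \<and> (\<forall>Q\<in>set Qs. semiprime_of A Q \<and> Q \<noteq> A) \<and>
      I = foldl (\<cdot>) J Qs \<longleftrightarrow>
      invertible_of A J \<and> Qs \<noteq> [] \<and> (\<forall>Q\<in>set Qs. semiprime_of A Q \<and> \<one> \<notin> Q) \<and>
      I = J \<cdot> ideal_prods A Qs" for I J Qs
  proof -
    have "Q \<noteq> A \<longleftrightarrow> \<one> \<notin> Q" if "semiprime_of A Q" for Q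
      using one_in_ideal_iff[OF True, of Q] that by (simp add: semiprime_of_def)
    moreover have "foldl (\<cdot>) J Qs = J \<cdot> ideal_prods A Qs"
      if "invertible_of A J" "\<forall>Q\<in>set Qs. semiprime_of A Q"
      by (rule foldl_ideal_prod[OF True])
        (use that in \<open>auto simp: invertible_of_def ideal_of_def semiprime_of_def\<close>)
    ultimately show ?thesis by (cases Qs) auto
  qed
  have "ideal_of A I \<and> I \<noteq> A \<and> I \<noteq> {\<zero>} \<longleftrightarrow> ideal_of A I \<and> \<one> \<notin> I \<and> I \<noteq> {\<zero>}" for I
    using one_in_ideal_iff[OF True, of I] by auto
  thus ?thesis
    unfolding ISP_domain_def isp_def prod ideal_iff_ideal_of[OF True] invertible_ideal_iff[OF True]
      radical_ideal_iff_semiprime_of[OF True] is_quotient_field_iff[OF True] fac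
    using True by simp
qed

end

theorem corollary9:
  fixes K :: "('a, 'm) ring_scheme" and A B :: "'a set"
  assumes "ISP_domain K A"
    and "overring K A B"
  shows "ISP_domain K B"
proof -
  interpret field K using assms(1) by (simp add: ISP_domain_def is_quotient_field_def)
  have A: "isp A" using assms(1) by (simp add: ISP_domain_iff_isp)
  moreover have "flat_overring A B"
    using isp_flat[OF A] assms(2) by (simp add: overring_def)
  ultimately show ?thesis using isp_flat_overring by (simp add: ISP_domain_iff_isp)
qed

end
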